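(* Let $X$ and $Y$ be standard Borel spaces, and let $i:X\to Y$ be a measurable embedding (i.e. an injective function such that the $\sigma$-algebra of $X$ is the pullback $\sigma$-algebra along $i$ of the $\sigma$-algebra of $Y$). Then the map $i_\sharp:PX\to PY$ (acting on couplings by $(i\times i)_\sharp$) is a full embedding of categories. If moreover $X$ and $Y$ are equipped with measurable cost functions and $i$ is an isometric embedding, then $i_\sharp:P_kX\to P_kY$ is an embedding of weighted categories for every integer $k\ge 1$.
   Context: For a measurable space $X$, $PX$ is the set of probability measures on $X$; for measurable $f:X\to Y$, $f_\sharp p(B)=p(f^{-1}(B))$. A coupling of $p\in PX$ and $q\in PY$ is a probability measure $s\in P(X\times Y)$ with marginals $p$ and $q$; $\Gamma(p,q)$ is the set of couplings. For standard Borel $X,Y$ and $s\in\Gamma(p,q)$, $\vec{s}$ denotes the ($p$-a.s. unique) Markov kernel from $X$ to $Y$ with $\int_A \vec{s}(B|x)\,p(dx)=s(A\times B)$ for all measurable $A,B$, and $\overleftarrow{s}$ the ($q$-a.s. unique) kernel from $Y$ to $X$ with $\int_B \overleftarrow{s}(A|y)\,q(dy)=s(A\times B)$. Category of couplings $PX$ ($X$ standard Borel): objects are the probability measures on $X$; morphisms $p\to q$ are the couplings $s\in\Gamma(p,q)$; the identity at $p$ is $I_p(A\times A')=p(A\cap A')$; the composite of $s\in\Gamma(p,q)$ and $t\in\Gamma(q,r)$ is $(t\circ s)(A\times C)=\int_X \overleftarrow{s}(A|y)\,\vec{t}(C|y)\,q(dy)$. A measurable cost function on $X$ is a measurable function $c:X\times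 X\to[0,\infty]$ that is a pq-metric: $c(x,x)=0$ and $c(x,z)\le c(x,y)+c(y,z)$. For an integer $k\ge1$, $P_kX$ is the category $PX$ where a morphism $s$ has weight $\mathrm{cost}_k(s)=\big(\int_{X\times X}c(x,y)^k\,s(dx\,dy)\big)^{1/k}$. The map $i$ is an isometric embedding if $c_Y(i(x),i(x'))=c_X(x,x')$ for all $x,x'$. A weighted category is a category with a weight $w(g)\in[0,\infty]$ for each arrow such that identities have weight $0$ and $w(h\circ g)\le w(h)+w(g)$. A weighted functor is a functor with $w(Fg)\le w(g)$. An embedding of weighted categories $F:\mathcal{C}\to\mathcal{D}$ is a weighted functor such that for all objects $C,C'$ of $\mathcal{C}$ the function $\mathrm{Hom}_{\mathcal{C}}(C,C')\to\mathrm{Hom}_{\mathcal{D}}(FC,FC')$, $g\mapsto Fg$, is a weight-preserving bijection. In the unweighted case (all weights zero), a full embedding of categories is a functor that is bijective on each hom-set. *)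

theory Defs
  imports "HOL-Probability.Probability"
begin

section \<open>Categories and weighted categories\<close>

text \<open>
  Hom-sets are not required to be disjoint; identities, composites, weights and the
  arrow maps of functors therefore take the objects involved as explicit arguments.
  \<open>Cmp C a b c g f\<close> is the composite of \<open>f : a \<rightarrow> b\<close> followed by \<open>g : b \<rightarrow> c\<close>.
\<close>

record ('o, 'm) cat =
  Obj :: "'o set"
  Hom :: "'o \<Rightarrow> 'o \<Rightarrow> 'm set"
  Idn :: "'o \<Rightarrow> 'm"
  Cmp :: "'o \<Rightarrow> 'o \<Rightarrow> 'o \<Rightarrow> 'm \<Rightarrow> 'm \<Rightarrow> 'm"

record ('o, 'm) weighted_cat = "('o, 'm) cat" +
  Wgt :: "'o \<Rightarrow> 'o \<Rightarrow> 'm \<Rightarrow> ennreal"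

locale category =
  fixes C :: "('o, 'm, 'z) cat_scheme"
  assumes idn_in_hom: "a \<in> Obj C \<Longrightarrow> Idn C a \<in> Hom C a a"
    and cmp_in_hom: "\<lbrakk>a \<in> Obj C; b \<in> Obj C; c \<in> Obj C; f \<in> Hom C a b; g \<in> Hom C b c\<rbrakk>
      \<Longrightarrow> Cmp C a b c g f \<in> Hom C a c"
    and cmp_idn_right: "\<lbrakk>a \<in> Obj C; b \<in> Obj C; f \<in> Hom C a b\<rbrakk> \<Longrightarrow> Cmp C a a b f (Idn C a) = f"
    and cmp_idn_left: "\<lbrakk>a \<in> Obj C; b \<in> Obj C; f \<in> Hom C a b\<rbrakk> \<Longrightarrow> Cmp C a b b (Idn C b) f = f"
    and cmp_assoc: "\<lbrakk>a \<in> Obj C; b \<in> Obj C; c \<in> Obj C; d \<in> Obj C;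
        f \<in> Hom C a b; g \<in> Hom C b c; h \<in> Hom C c d\<rbrakk>
      \<Longrightarrow> Cmp C a c d h (Cmp C a b c g f) = Cmp C a b d (Cmp C b c d h g) f"

locale weighted_category = category C
  for C :: "('o, 'm, 'z) weighted_cat_scheme" +
  assumes wgt_idn: "a \<in> Obj C \<Longrightarrow> Wgt C a a (Idn C a) = 0"
    and wgt_cmp: "\<lbrakk>a \<in> Obj C; b \<in> Obj C; c \<in> Obj C; f \<in> Hom C a b; g \<in> Hom C b c\<rbrakk>
      \<Longrightarrow> Wgt C a c (Cmp C a b c g f) \<le> Wgt C b c g + Wgt C a b f"

locale cat_functor = source: category C + target: category D
  for C :: "('o, 'm, 'z) cat_scheme" and D :: "('p, 'n, 'w) cat_scheme" +
  fixes Fo :: "'o \<Rightarrow> 'p" and Fa :: "'o \<Rightarrow> 'o \<Rightarrow> 'm \<Rightarrow> 'n"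
  assumes fun_obj: "a \<in> Obj C \<Longrightarrow> Fo a \<in> Obj D"
    and fun_hom: "\<lbrakk>a \<in> Obj C; b \<in> Obj C; f \<in> Hom C a b\<rbrakk> \<Longrightarrow> Fa a b f \<in> Hom D (Fo a) (Fo b)"
    and fun_idn: "a \<in> Obj C \<Longrightarrow> Fa a a (Idn C a) = Idn D (Fo a)"
    and fun_cmp: "\<lbrakk>a \<in> Obj C; b \<in> Obj C; c \<in> Obj C; f \<in> Hom C a b; g \<in> Hom C b c\<rbrakk>
      \<Longrightarrow> Fa a c (Cmp C a b c g f) = Cmp D (Fo a) (Fo b) (Fo c) (Fa b c g) (Fa a b f)"

locale full_embedding = cat_functor C D Fo Fa
  for C :: "('o, 'm, 'z) cat_scheme" and D :: "('p, 'n, 'w) cat_scheme" and Fo Fa +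
  assumes bij_hom: "\<lbrakk>a \<in> Obj C; b \<in> Obj C\<rbrakk>
      \<Longrightarrow> bij_betw (Fa a b) (Hom C a b) (Hom D (Fo a) (Fo b))"

locale weighted_functor = cat_functor C D Fo Fa + source: weighted_category C + target: weighted_category D
  for C :: "('o, 'm, 'z) weighted_cat_scheme" and D :: "('p, 'n, 'w) weighted_cat_scheme"
    and Fo Fa +
  assumes wgt_fun_le: "\<lbrakk>a \<in> Obj C; b \<in> Obj C; f \<in> Hom C a b\<rbrakk>
      \<Longrightarrow> Wgt D (Fo a) (Fo b) (Fa a b f) \<le> Wgt C a b f"

locale weighted_embedding = weighted_functor C D Fo Fa
  for C :: "('o, 'm, 'z) weighted_cat_scheme" and D :: "('p, 'n, 'w) weighted_cat_scheme"
    and Fo Fa +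
  assumes bij_hom: "\<lbrakk>a \<in> Obj C; b \<in> Obj C\<rbrakk>
      \<Longrightarrow> bij_betw (Fa a b) (Hom C a b) (Hom D (Fo a) (Fo b))"
    and wgt_fun_eq: "\<lbrakk>a \<in> Obj C; b \<in> Obj C; f \<in> Hom C a b\<rbrakk>
      \<Longrightarrow> Wgt D (Fo a) (Fo b) (Fa a b f) = Wgt C a b f"


section \<open>Standard Borel spaces and measurable embeddings\<close>

text \<open>A measurable space is represented by a \<open>measure\<close> of which only \<open>space\<close> and \<open>sets\<close> matter.\<close>

definition standard_borel :: "'a measure \<Rightarrow> bool" where
  "standard_borel X \<longleftrightarrow> (\<exists>T. topspace T = space X \<and> completely_metrizable_space T \<and>
     separable_space T \<and> sets X = sigma_sets (space X) {U. openin T U})"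

definition measurable_embedding :: "'a measure \<Rightarrow> 'b measure \<Rightarrow> ('a \<Rightarrow> 'b) \<Rightarrow> bool" where
  "measurable_embedding X Y i \<longleftrightarrow> i \<in> space X \<rightarrow> space Y \<and> inj_on i (space X) \<and>
     sets X = {i -` B \<inter> space X | B. B \<in> sets Y}"


section \<open>Couplings\<close>

text \<open>For a measurable space \<open>X\<close>, the set of probability measures on \<open>X\<close> is \<open>space (prob_algebra X)\<close>.\<close>

definition couplings :: "'a measure \<Rightarrow> 'b measure \<Rightarrow> ('a \<times> 'b) measure set" where
  "couplings p q = {s \<in> space (prob_algebra (p \<Otimes>\<^sub>M q)). distr s p fst = p \<and> distr s q snd = q}"

text \<open>
  Disintegrations are determined only almost surely; an arbitrary version is chosen. The
  composite below does not depend on the choice.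
\<close>

definition forward_kernel ::
    "'a measure \<Rightarrow> 'b measure \<Rightarrow> ('a \<times> 'b) measure \<Rightarrow> 'a \<Rightarrow> 'b measure" where
  "forward_kernel p q s = (SOME K. K \<in> p \<rightarrow>\<^sub>M prob_algebra q \<and>
     (\<forall>A\<in>sets p. \<forall>B\<in>sets q. (\<integral>\<^sup>+x\<in>A. emeasure (K x) B \<partial>p) = emeasure s (A \<times> B)))"

definition backward_kernel ::
    "'a measure \<Rightarrow> 'b measure \<Rightarrow> ('a \<times> 'b) measure \<Rightarrow> 'b \<Rightarrow> 'a measure" where
  "backward_kernel p q s = (SOME K. K \<in> q \<rightarrow>\<^sub>M prob_algebra p \<and>
     (\<forall>A\<in>sets p. \<forall>B\<in>sets q. (\<integral>\<^sup>+y\<in>B. emeasure (K y) A \<partial>q) = emeasure s (A \<times> B)))"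

text \<open>
  The measure on the product with prescribed values on measurable rectangles. For the two
  prescriptions used below it is unique, rectangles being an intersection-stable generator that
  contains the whole space.
\<close>

definition measure_by_rectangles ::
    "'a measure \<Rightarrow> 'b measure \<Rightarrow> ('a set \<Rightarrow> 'b set \<Rightarrow> ennreal) \<Rightarrow> ('a \<times> 'b) measure" where
  "measure_by_rectangles p r \<phi> = (THE u. sets u = sets (p \<Otimes>\<^sub>M r) \<and>
     (\<forall>A\<in>sets p. \<forall>C\<in>sets r. emeasure u (A \<times> C) = \<phi> A C))"

definition identity_coupling :: "'a measure \<Rightarrow> ('a \<times> 'a) measure" where
  "identity_coupling p = measure_by_rectangles p p (\<lambda>A A'. emeasure p (A \<inter> A'))"

definition compose_couplings ::
    "'a measure \<Rightarrow> 'b measure \<Rightarrow> 'c measure \<Rightarrow> ('b \<times> 'c) measure \<Rightarrow> ('a \<times> 'b) measure \<Rightarrow>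
      ('a \<times> 'c) measure" where
  "compose_couplings p q r t s = measure_by_rectangles p r (\<lambda>A C.
     \<integral>\<^sup>+y. emeasure (backward_kernel p q s y) A * emeasure (forward_kernel q r t y) C \<partial>q)"

definition coupling_cat :: "'a measure \<Rightarrow> ('a measure, ('a \<times> 'a) measure) cat" where
  "coupling_cat X =
     \<lparr>Obj = space (prob_algebra X), Hom = couplings, Idn = identity_coupling,
      Cmp = compose_couplings\<rparr>"


section \<open>Costs\<close>

definition cost_function :: "'a measure \<Rightarrow> ('a \<Rightarrow> 'a \<Rightarrow> ennreal) \<Rightarrow> bool" where
  "cost_function X c \<longleftrightarrow> case_prod c \<in> borel_measurable (X \<Otimes>\<^sub>M X) \<and>
     (\<forall>x\<in>space X. c x x = 0) \<and>
     (\<forall>x\<in>space X. \<forall>y\<in>space X. \<forall>z\<in>space X. c x z \<le> c x y + c y z)"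

definition isometric_embedding ::
    "'a measure \<Rightarrow> ('a \<Rightarrow> 'a \<Rightarrow> ennreal) \<Rightarrow> ('b \<Rightarrow> 'b \<Rightarrow> ennreal) \<Rightarrow> ('a \<Rightarrow> 'b) \<Rightarrow> bool" where
  "isometric_embedding X cX cY i \<longleftrightarrow>
     (\<forall>x\<in>space X. \<forall>x'\<in>space X. cY (i x) (i x') = cX x x')"

definition ennreal_root :: "nat \<Rightarrow> ennreal \<Rightarrow> ennreal" where
  "ennreal_root k x = (if x = \<infinity> then \<infinity> else ennreal (root k (enn2real x)))"

definition coupling_cost :: "nat \<Rightarrow> ('a \<Rightarrow> 'b \<Rightarrow> ennreal) \<Rightarrow> ('a \<times> 'b) measure \<Rightarrow> ennreal" where
  "coupling_cost k c s = ennreal_root k (\<integral>\<^sup>+(x, y). c x y ^ k \<partial>s)"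

definition weighted_coupling_cat ::
    "nat \<Rightarrow> 'a measure \<Rightarrow> ('a \<Rightarrow> 'a \<Rightarrow> ennreal) \<Rightarrow>
      ('a measure, ('a \<times> 'a) measure) weighted_cat" where
  "weighted_coupling_cat k X c = cat.extend (coupling_cat X)
     (weighted_cat.fields (\<lambda>_ _ s. coupling_cost k c s))"

definition push_obj :: "'b measure \<Rightarrow> ('a \<Rightarrow> 'b) \<Rightarrow> 'a measure \<Rightarrow> 'b measure" where
  "push_obj Y i p = distr p Y i"

definition push_arr :: "'b measure \<Rightarrow> ('a \<Rightarrow> 'b) \<Rightarrow> 'a measure \<Rightarrow> 'a measure \<Rightarrow>
    ('a \<times> 'a) measure \<Rightarrow> ('b \<times> 'b) measure" where
  "push_arr Y i p q s = distr s (Y \<Otimes>\<^sub>M Y) (map_prod i i)"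

end

theory Submission
  imports Defs
begin

text \<open>
  A coupling \<open>s\<close> of \<open>p\<close> and \<open>q\<close> on standard Borel spaces is the same thing as a Markov kernel that
  carries \<open>p\<close> to \<open>q\<close>, up to \<open>p\<close>-null sets. Under this correspondence the identity coupling is the Dirac kernel
  (\<open>identity_coupling_kernel\<close>) and the composite of couplings is the composite of kernels
  (\<open>compose_couplings_kernel\<close>), so the laws of a category are the monad laws of the probability monad.
  The correspondence rests on the disintegration theorem \<open>kernel_exists\<close>.

  If \<open>X\<close> is nonempty, \<open>i\<close> has a measurable left inverse \<open>J : Y \<rightarrow> X\<close>, and its range is the measurable set of fixed
  points of \<open>i \<circ> J\<close>. A coupling of two pushed-forward measures lives on the square of the range, where
  \<open>i \<circ> J\<close> is the identity; hence pushing forward along \<open>J\<close> inverts pushing forward along \<open>i\<close> on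
  hom-sets (\<open>bij_push_arr\<close>). Functoriality follows by transporting kernels along \<open>i\<close> and \<open>J\<close>.

  Both disintegration and the left inverse are reduced to the real line: a nonempty standard Borel
  space is a measurable retract of the line (\<open>standard_borel_real_coding\<close>). On the line a kernel
  is sampled from its conditional tail probabilities, and a measurable function on a subspace extends
  through its rational level sets; composing with the retraction gives the general case.

  For costs, the triangle inequality is integrated against the gluing of two couplings, where
  Minkowski's inequality \<open>minkowski_nn_integral\<close> bounds the cost of a composite. A change of variables
  shows that an isometric \<open>i\<close> preserves costs.
\<close>

section \<open>Standard Borel spaces as measurable retracts of the line\<close>

text \<open>
  A coding exhibits \<open>Y\<close> as a measurable retract of the real line. As \<open>L\<close> is measurable on the whole
  line, kernels and functions built on the line are transported to \<open>Y\<close> by composition with \<open>L\<close>. The range \<open>[0, 1)\<close> of \<open>f\<close> lets suprema of rational levels in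
  \<open>[0, 1]\<close> recover the values of \<open>f\<close>.
\<close>

definition real_coding :: "'a measure \<Rightarrow> ('a \<Rightarrow> real) \<Rightarrow> (real \<Rightarrow> 'a) \<Rightarrow> bool" where
  "real_coding Y f L \<longleftrightarrow> f \<in> borel_measurable Y \<and> L \<in> borel \<rightarrow>\<^sub>M Y \<and>
     (\<forall>y\<in>space Y. 0 \<le> f y \<and> f y < 1 \<and> L (f y) = y)"

text \<open>
  A bit sequence is stored as the base 4 digits 0 and 1 of a real number. In base 4 the tail after
  any position is at most 1/3 of a unit of that position, so digits are read off by rounding down and
  no two bit sequences share a number; base 2 would suffer from carries.
\<close>

definition base4 :: "(nat \<Rightarrow> bool) \<Rightarrow> real" where
  "base4 b = (\<Sum>n. of_bool (b n) * (1/4) ^ Suc n)"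

lemma summable_base4: "summable (\<lambda>n. of_bool (b n) * (1/4::real) ^ Suc n)"
proof (rule summable_comparison_test')
  show "summable (\<lambda>n. (1/4::real) ^ Suc n)"
    by (simp add: summable_geometric)
qed auto

lemma base4_bounds: "0 \<le> base4 b" "base4 b \<le> 1/3"
proof -
  show "0 \<le> base4 b"
    unfolding base4_def by (intro suminf_nonneg summable_base4) auto
  have "base4 b \<le> (\<Sum>n. (1/4::real) ^ Suc n)"
    unfolding base4_def by (intro suminf_le summable_base4) (auto simp: summable_geometric)
  also have "(\<Sum>n. (1/4::real) ^ Suc n) = (1/4) * (\<Sum>n. (1/4::real) ^ n)"
    by (subst suminf_mult[symmetric]) (auto simp: summable_geometric)
  also have "\<dots> = 1/3"
    by (subst suminf_geometric) auto
  finally show "base4 b \<le> 1/3" .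
qed

lemma base4_unfold: "4 * base4 b = of_bool (b 0) + base4 (\<lambda>n. b (Suc n))"
proof -
  have "base4 b = of_bool (b 0) / 4 + (\<Sum>n. of_bool (b (Suc n)) * (1/4) ^ Suc (Suc n))"
    unfolding base4_def using suminf_split_head[OF summable_base4[of b]] by simp
  also have "(\<Sum>n. of_bool (b (Suc n)) * (1/4::real) ^ Suc (Suc n)) = (1/4) * base4 (\<lambda>n. b (Suc n))"
    unfolding base4_def
    by (subst suminf_mult[OF summable_base4, symmetric]) (simp add: mult_ac)
  finally show ?thesis by simp
qed

definition digit4 :: "nat \<Rightarrow> real \<Rightarrow> bool" where
  "digit4 n z \<longleftrightarrow> \<lfloor>4 ^ Suc n * z\<rfloor> mod 4 = 1"

lemma digit4_base4: "digit4 n (base4 b) \<longleftrightarrow> b n"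
proof (induction n arbitrary: b)
  case 0
  have "\<lfloor>4 * base4 b\<rfloor> = of_bool (b 0)"
    unfolding base4_unfold[of b] using base4_bounds[of "\<lambda>n. b (Suc n)"]
    by (intro floor_unique) auto
  then show ?case by (simp add: digit4_def)
next
  case (Suc n)
  have "4 ^ Suc (Suc n) * base4 b = 4 ^ Suc n * (4 * base4 b)" by simp
  also have "\<dots> = 4 ^ Suc n * base4 (\<lambda>n. b (Suc n)) + of_int (4 * (4 ^ n * of_bool (b 0)))"
    unfolding base4_unfold by (simp add: algebra_simps)
  finally have "\<lfloor>4 ^ Suc (Suc n) * base4 b\<rfloor> = \<lfloor>4 ^ Suc n * base4 (\<lambda>n. b (Suc n))\<rfloor> + 4 * (4 ^ n * of_bool (b 0))"
    by (simp only: floor_add_int)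
  then have "digit4 (Suc n) (base4 b) = digit4 n (base4 (\<lambda>n. b (Suc n)))"
    unfolding digit4_def by (simp only: mod_mult_self2)
  with Suc.IH show ?case by simp
qed

lemma measurable_digit4[measurable]: "Measurable.pred borel (digit4 n)"
  unfolding digit4_def by measurable

text \<open>
  A point is coded by the bits that tell in which of the balls of radius \<open>1 / Suc k\<close> around a dense
  sequence \<open>e\<close> it lies. To decode a number, the first centre whose bit for radius \<open>1 / Suc k\<close> is set is a
  \<open>k\<close>-th approximation, and the decoded point is the limit of the approximations. Numbers that code no
  point may have a sequence of approximations that is not Cauchy; these form a Borel set and are sent
  to \<open>e 0\<close>, while completeness provides the limit everywhere else.
\<close>

lemma standard_borel_real_coding:
  assumes "standard_borel Y" "space Y \<noteq> {}"
  shows "\<exists>f L. real_coding Y f L"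
proof -
  obtain T where T: "topspace T = space Y" "completely_metrizable_space T" "separable_space T"
    and sets_Y: "sets Y = sigma_sets (space Y) {U. openin T U}"
    using assms(1) by (auto simp: standard_borel_def)
  obtain M d where "Metric_space M d" and complete: "Metric_space.mcomplete M d"
    and T_eq: "T = Metric_space.mtopology M d"
    using T(2) by (auto simp: completely_metrizable_space_def)
  interpret Metric_space M d by fact
  have M: "M = space Y" using T(1) T_eq by simp
  obtain D where D: "countable D" "D \<subseteq> M" "mtopology closure_of D = M"
    using T(3) unfolding T_eq separable_space_def topspace_mtopology by blast
  have "D \<noteq> {}" using D(3) assms(2) M by auto
  define e where "e = from_nat_into D"
  have e_M[simp]: "e i \<in> M" for i
    using D(2) \<open>D \<noteq> {}\<close> from_nat_into[of D i] by (auto simp: e_def)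
  have dense: "\<exists>i. d (e i) x < r" if "x \<in> M" "0 < r" for x r
  proof -
    obtain y where "y \<in> D" "y \<in> mball x r"
      using D(3) \<open>x \<in> M\<close> \<open>0 < r\<close> unfolding metric_closure_of by blast
    moreover obtain i where "e i = y"
      using from_nat_into_surj[OF D(1) \<open>y \<in> D\<close>] by (auto simp: e_def)
    ultimately show ?thesis by (auto simp: commute)
  qed
  have open_sets: "U \<in> sets Y" if "openin mtopology U" for U
    using that unfolding sets_Y T_eq by (auto intro: sigma_sets.Basic)

  define f where "f x = base4 (\<lambda>n. case prod_decode n of (i, k) \<Rightarrow> d (e i) x < 1 / Suc k)" for x
  have [measurable]: "Measurable.pred Y (\<lambda>x. d (e i) x < r)" for i r
  proof -
    have "{x \<in> space Y. d (e i) x < r} = mball (e i) r"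
      by (auto simp: M[symmetric])
    then show ?thesis
      using open_sets[of "mball (e i) r"] by (simp add: pred_def)
  qed
  have f_meas: "f \<in> borel_measurable Y"
    unfolding f_def base4_def case_prod_beta by measurable
  have digit_f: "digit4 (prod_encode (i, k)) (f x) \<longleftrightarrow> d (e i) x < 1 / Suc k" for i k x
    unfolding f_def digit4_base4 by simp

  define I where "I k z = (LEAST i. digit4 (prod_encode (i, k)) z)" for k z
  have [measurable]: "I k \<in> borel \<rightarrow>\<^sub>M count_space UNIV" for k
    unfolding I_def by measurable
  have I_close: "d (e (I k (f x))) x < 1 / Suc k" if x: "x \<in> M" for k x
  proof -
    obtain i where "d (e i) x < 1 / Suc k" using dense[OF x, of "1 / Suc k"] by auto
    then have "digit4 (prod_encode (i, k)) (f x)" by (simp add: digit_f)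
    then have "digit4 (prod_encode (I k (f x), k)) (f x)"
      unfolding I_def by (rule LeastI)
    then show ?thesis by (simp only: digit_f)
  qed

  define good where
    "good z \<longleftrightarrow> (\<forall>j. \<exists>N. \<forall>n\<ge>N. \<forall>m\<ge>N. d (e (I n z)) (e (I m z)) < 1 / Suc j)" for z :: real
  have dI[measurable]: "(\<lambda>z. d (e (I n z)) (e (I m z))) \<in> borel_measurable borel" for n m
    by measurable
  have dI'[measurable]: "(\<lambda>z. d (e (I n z)) x) \<in> borel_measurable borel" for n x
    by measurable
  have [measurable]: "Measurable.pred borel good"
    unfolding good_def by measurable
  have good_limit: "\<exists>l. limitin mtopology (\<lambda>k. e (I k z)) l sequentially" if "good z" for z
  proof -
    have "MCauchy (\<lambda>k. e (I k z))"
      unfolding MCauchy_def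
    proof (intro conjI strip)
      show "range (\<lambda>k. e (I k z)) \<subseteq> M" by auto
      fix \<epsilon> :: real assume "0 < \<epsilon>"
      then obtain j where "1 / Suc j < \<epsilon>"
        using nat_approx_posE by blast
      then show "\<exists>N. \<forall>n n'. N \<le> n \<longrightarrow> N \<le> n' \<longrightarrow> d (e (I n z)) (e (I n' z)) < \<epsilon>"
        using that unfolding good_def by (meson less_trans)
    qed
    then show ?thesis using complete by (simp add: mcomplete_def)
  qed
  define L where
    "L z = (if good z then SOME l. limitin mtopology (\<lambda>k. e (I k z)) l sequentially else e 0)" for z
  have L_limit: "limitin mtopology (\<lambda>k. e (I k z)) (L z) sequentially" if "good z" for z
    using someI_ex[OF good_limit[OF that]] that by (simp add: L_def)
  have L_M[simp]: "L z \<in> M" for z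
  proof (cases "good z")
    case True
    then show ?thesis using L_limit limitin_mspace by blast
  qed (simp add: L_def)
  \<comment> \<open>The decoder is measurable because its distance to each fixed point is a pointwise limit of
    functions that depend on countably many digits, and the balls around \<open>e\<close> generate.\<close>
  have dist_L: "d (L z) x = (if good z then lim (\<lambda>k. d (e (I k z)) x) else d (e 0) x)"
    if "x \<in> M" for z x
  proof (cases "good z")
    case True
    have "(\<lambda>k. d (e (I k z)) (L z)) \<longlonglongrightarrow> 0"
      using L_limit[OF True] by (simp add: limitin_metric_dist_null)
    moreover have "\<forall>k. norm (d (e (I k z)) x - d (L z) x) \<le> d (e (I k z)) (L z)"
      using that L_M[of z] e_M by (smt (verit) commute triangle real_norm_def)
    ultimately have "(\<lambda>k. d (e (I k z)) x - d (L z) x) \<longlonglongrightarrow> 0"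
      by (rule Lim_null_comparison[OF always_eventually, rotated])
    then have "(\<lambda>k. d (e (I k z)) x) \<longlonglongrightarrow> d (L z) x"
      by (simp add: LIM_zero_iff)
    then show ?thesis using True by (simp add: limI)
  qed (simp add: L_def)
  have dL[measurable]: "(\<lambda>z. d (L z) x) \<in> borel_measurable borel" if "x \<in> M" for x
    unfolding dist_L[OF that] by measurable
  have L_meas: "L \<in> borel \<rightarrow>\<^sub>M Y"
  proof (rule measurable_sigma_sets[OF sets_Y])
    show "{U. openin T U} \<subseteq> Pow (space Y)" using openin_subset T(1) by auto
    show "L \<in> space borel \<rightarrow> space Y" by (simp add: M[symmetric])
    fix U assume "U \<in> {U. openin T U}"
    then have U: "openin mtopology U" by (simp add: T_eq)
    have "L -` U \<inter> space borel =
      (\<Union>(i, k) \<in> {(i, k). mball (e i) (1 / Suc k) \<subseteq> U}. {z. d (L z) (e i) < 1 / Suc k})"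
      (is "_ = ?R")
    proof (intro set_eqI iffI)
      fix z assume "z \<in> L -` U \<inter> space borel"
      then obtain r where r: "0 < r" "mball (L z) r \<subseteq> U"
        using U by (auto simp: openin_mtopology)
      obtain k where k: "1 / Suc k < r / 2"
        using nat_approx_posE[of "r/2"] r(1) by auto
      obtain i where i: "d (e i) (L z) < 1 / Suc k"
        using dense[of "L z" "1 / Suc k"] by auto
      have "mball (e i) (1 / Suc k) \<subseteq> mball (L z) r"
      proof
        fix y assume y: "y \<in> mball (e i) (1 / Suc k)"
        then have "d (L z) y \<le> d (L z) (e i) + d (e i) y"
          by (intro triangle) auto
        with y i k show "y \<in> mball (L z) r" by (auto simp: commute)
      qed
      with r i show "z \<in> ?R" by (auto simp: commute)
    next
      fix z assume "z \<in> ?R"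
      then obtain i k where "mball (e i) (1 / Suc k) \<subseteq> U" "d (L z) (e i) < 1 / Suc k"
        by auto
      then show "z \<in> L -` U \<inter> space borel" by (auto simp: commute subset_iff)
    qed
    also have "?R \<in> sets borel"
    proof (rule sets.countable_UN'')
      fix p assume "p \<in> {(i, k). mball (e i) (1 / real (Suc k)) \<subseteq> U}"
      have "{z. d (L z) (e i) < 1 / real (Suc k)} \<in> sets borel" for i k
        using borel_measurable_less[OF dL[OF e_M[of i]] borel_measurable_const] by simp
      then show "(case p of (i, k) \<Rightarrow> {z. d (L z) (e i) < 1 / real (Suc k)}) \<in> sets borel"
        by (cases p) simp
    qed auto
    finally show "L -` U \<inter> space borel \<in> sets borel" .
  qed
  have L_f: "L (f x) = x" if "x \<in> M" for x
  proof -
    have lim: "limitin mtopology (\<lambda>k. e (I k (f x))) x sequentially"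
      unfolding limitin_metric_dist_null
    proof (intro conjI)
      show "\<forall>\<^sub>F k in sequentially. e (I k (f x)) \<in> M" by simp
      show "(\<lambda>k. d (e (I k (f x))) x) \<longlonglongrightarrow> 0"
      proof (rule tendsto_sandwich[OF _ _ tendsto_const LIMSEQ_inverse_real_of_nat])
        show "\<forall>\<^sub>F n in sequentially. d (e (I n (f x))) x \<le> inverse (real (Suc n))"
          using I_close[OF that] by (intro always_eventually) (auto simp: field_simps less_imp_le)
      qed simp
    qed fact
    then have "MCauchy (\<lambda>k. e (I k (f x)))"
      by (intro convergent_imp_MCauchy) auto
    then have "\<exists>N. \<forall>n n'. N \<le> n \<longrightarrow> N \<le> n' \<longrightarrow> d (e (I n (f x))) (e (I n' (f x))) < 1 / Suc j" for j
      by (simp add: MCauchy_def)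
    then have "good (f x)"
      unfolding good_def by blast
    from L_limit[OF this] lim show ?thesis
      by (rule limitin_metric_unique) simp
  qed
  have "0 \<le> f y" "f y < 1" for y
    unfolding f_def using base4_bounds(1) le_less_trans[OF base4_bounds(2), of 1] by simp_all
  with f_meas L_meas L_f have "real_coding Y f L"
    by (simp add: real_coding_def M[symmetric])
  then show ?thesis by blast
qed

lemma standard_borel_cong:
  assumes "standard_borel X" "sets M = sets X"
  shows "standard_borel M"
  using assms sets_eq_imp_space_eq[OF assms(2)] by (simp add: standard_borel_def)

section \<open>Functions recovered from rational level sets\<close>

text \<open>
  A real function \<open>h\<close> with values in \<open>[0, 1)\<close> is recovered from its level sets as the supremum of the
  rational \<open>r\<close> with \<open>r < h x\<close>. Replacing the condition \<open>r < h x\<close> by an arbitrary measurable predicate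
  still gives a measurable function, since only countably many levels occur. The \<open>0\<close> in the other
  branch and the bound 1 on the levels make the supremum one of a nonempty bounded set.
\<close>

definition level_sup :: "(real \<Rightarrow> bool) \<Rightarrow> real" where
  "level_sup P = (SUP r\<in>\<rat> \<inter> {0..1}. if P r then r else 0)"

lemma level_sup_bdd: "bdd_above ((\<lambda>r. if P r then r else 0) ` (\<rat> \<inter> {0..1::real}))"
  by (rule bdd_aboveI[where M = 1]) auto

lemma countable_levels: "countable (\<rat> \<inter> {0..1::real})"
  using countable_rat by auto

lemma levels_nonempty: "\<rat> \<inter> {0..1::real} \<noteq> {}"
  using Rats_0 by force

lemma level_sup_gt:
  assumes "0 \<le> t"
  shows "t < level_sup P \<longleftrightarrow> (\<exists>r\<in>\<rat> \<inter> {0..1}. t < r \<and> P r)"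
  unfolding level_sup_def
  by (subst less_cSUP_iff[OF levels_nonempty level_sup_bdd]) (use assms in auto)

lemma level_sup_nonneg: "0 \<le> level_sup P"
proof -
  have "(0::real) \<in> \<rat> \<inter> {0..1}" by simp
  from cSUP_upper[OF this level_sup_bdd[of P]] show ?thesis
    unfolding level_sup_def by (simp split: if_splits)
qed

lemma level_sup_less: 
  assumes "0 \<le> v" "v < 1"
  shows "level_sup (\<lambda>r. r < v) = v"
proof (rule antisym)
  show "level_sup (\<lambda>r. r < v) \<le> v"
    unfolding level_sup_def by (rule cSUP_least[OF levels_nonempty]) (use assms in auto)
  show "v \<le> level_sup (\<lambda>r. r < v)"
  proof (rule dense_le)
    fix t assume "t < v"
    show "t \<le> level_sup (\<lambda>r. r < v)"
    proof (cases "0 \<le> t")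
      case True
      obtain r where r: "r \<in> \<rat>" "t < r" "r < v"
        using Rats_dense_in_real[OF \<open>t < v\<close>] by blast
      then have "r \<in> \<rat> \<inter> {0..1}" using True assms by simp
      then have "t < level_sup (\<lambda>r. r < v)"
        using r level_sup_gt[OF True] by blast
      then show ?thesis by simp
    next
      case False
      then show ?thesis using level_sup_nonneg[of "\<lambda>r. r < v"] by linarith
    qed
  qed
qed

lemma measurable_level_sup[measurable (raw)]:
  assumes [measurable]: "\<And>r. r \<in> \<rat> \<inter> {0..1} \<Longrightarrow> Measurable.pred M (\<lambda>x. P x r)"
  shows "(\<lambda>x. level_sup (P x)) \<in> borel_measurable M"
  unfolding level_sup_def
  by (rule borel_measurable_cSUP[OF countable_levels _ level_sup_bdd]) measurable

text \<open>
  Right continuity of tail probabilities is used along such a sequence of admissible levels.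
\<close>

lemma rational_decseq:
  assumes "0 \<le> t" "t < (1::real)"
  obtains r where "\<And>n. r n \<in> \<rat> \<inter> {0..1}" "\<And>n. t < r n" "decseq r" "r \<longlonglongrightarrow> t"
proof -
  have "\<exists>g\<in>\<rat>. t < g \<and> g < min 1 (t + 1 / Suc n)" for n
    by (rule Rats_dense_in_real) (use assms in simp)
  then obtain g where g: "\<And>n. g n \<in> \<rat>" "\<And>n. t < g n" "\<And>n. g n < min 1 (t + 1 / Suc n)"
    by metis
  define r where "r n = Min (g ` {..n})" for n
  have r_in: "r n \<in> g ` {..n}" for n
    unfolding r_def by (rule Min_in) auto
  have r_le: "r n \<le> g n" for n
    unfolding r_def by (rule Min_le) auto
  show ?thesis
  proof
    show "t < r n" for n using r_in[of n] g(2) by auto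
    show "r n \<in> \<rat> \<inter> {0..1}" for n
      using r_in[of n] g assms by (auto simp: less_imp_le) (meson assms(1) g(2) le_less_trans less_imp_le)
    show "decseq r"
      unfolding r_def by (intro antimonoI Min_antimono) auto
    show "r \<longlonglongrightarrow> t"
    proof (rule tendsto_sandwich[OF _ _ tendsto_const])
      show "\<forall>\<^sub>F n in sequentially. t \<le> r n"
        using \<open>\<And>n. t < r n\<close> by (simp add: less_imp_le)
      show "\<forall>\<^sub>F n in sequentially. r n \<le> t + 1 / Suc n"
        by (intro always_eventually allI) (meson r_le g(3) min.strict_boundedE less_imp_le order_trans)
      show "(\<lambda>n. t + 1 / Suc n) \<longlonglongrightarrow> t"
        using tendsto_add[OF tendsto_const LIMSEQ_inverse_real_of_nat, of t] by (simp add: inverse_eq_divide)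
    qed
  qed
qed

section \<open>Left inverses of measurable embeddings\<close>

lemma measurable_embedding_measurable:
  assumes "measurable_embedding X Y i"
  shows "i \<in> X \<rightarrow>\<^sub>M Y"
proof (rule measurableI)
  show "i x \<in> space Y" if "x \<in> space X" for x
    using assms that unfolding measurable_embedding_def by blast
  show "i -` B \<inter> space X \<in> sets X" if "B \<in> sets Y" for B
    using assms that unfolding measurable_embedding_def by blast
qed

text \<open>
  Each level set of the code of \<open>X\<close> is the preimage of a set measurable in \<open>Y\<close>. These countably many
  sets define a function on all of \<open>Y\<close> that extends the code along \<open>i\<close>; decoding it gives a left
  inverse of \<open>i\<close>.
\<close>

lemma measurable_embedding_left_inverse:
  assumes emb: "measurable_embedding X Y i" and coding: "real_coding X f L"
  shows "\<exists>J. J \<in> Y \<rightarrow>\<^sub>M X \<and> (\<forall>x\<in>space X. J (i x) = x)"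
proof -
  have [measurable]: "f \<in> borel_measurable X" "L \<in> borel \<rightarrow>\<^sub>M X"
    and f_code: "\<And>x. x \<in> space X \<Longrightarrow> 0 \<le> f x \<and> f x < 1 \<and> L (f x) = x"
    using coding by (auto simp: real_coding_def)
  have "\<exists>B. B \<in> sets Y \<and> {x \<in> space X. r < f x} = i -` B \<inter> space X" for r
  proof -
    have "{x \<in> space X. r < f x} \<in> sets X" by measurable
    then show ?thesis using emb unfolding measurable_embedding_def by blast
  qed
  then obtain B where [measurable]: "\<And>r. B r \<in> sets Y"
    and B: "\<And>r. {x \<in> space X. r < f x} = i -` B r \<inter> space X"
    by metis
  define J where "J y = L (level_sup (\<lambda>r. y \<in> B r))" for y
  have "J \<in> Y \<rightarrow>\<^sub>M X"
    unfolding J_def by measurable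
  moreover have "J (i x) = x" if x: "x \<in> space X" for x
  proof -
    have "i x \<in> B r \<longleftrightarrow> r < f x" for r using B[of r] x by blast
    then show ?thesis using f_code[OF x] by (simp add: J_def level_sup_less)
  qed
  ultimately show ?thesis by blast
qed

text \<open>
  A code is injective on \<open>space Y\<close>, so the set is where two real functions agree. For \<open>g = i \<circ> J\<close> and \<open>h\<close> the identity, with \<open>J\<close> a left inverse of \<open>i\<close>, this set is the range of the
  embedding \<open>i\<close>.
\<close>

lemma real_coding_equalizer:
  assumes "real_coding Y f L" and [measurable]: "g \<in> M \<rightarrow>\<^sub>M Y" "h \<in> M \<rightarrow>\<^sub>M Y"
  shows "{x \<in> space M. g x = h x} \<in> sets M"
proof -
  have [measurable]: "f \<in> borel_measurable Y" 
    and inj: "\<And>y. y \<in> space Y \<Longrightarrow> L (f y) = y"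
    using assms(1) by (auto simp: real_coding_def)
  have "{x \<in> space M. g x = h x} = {x \<in> space M. f (g x) = f (h x)}"
    using inj[OF measurable_space[OF assms(2)]] inj[OF measurable_space[OF assms(3)]]
    by (intro Collect_cong conj_cong refl iffI) (simp, metis)
  also have "\<dots> \<in> sets M" by measurable
  finally show ?thesis .
qed

section \<open>Disintegration\<close>

text \<open>
  Comparing the integrals over the set where the inequality fails gives the contradiction; the
  inequality between these integrals is strict because that of \<open>g\<close> is finite.
\<close>

lemma AE_le_of_set_nn_integral_le:
  assumes [measurable]: "f \<in> borel_measurable M" "g \<in> borel_measurable M"
    and le: "\<And>A. A \<in> sets M \<Longrightarrow> (\<integral>\<^sup>+x\<in>A. f x \<partial>M) \<le> (\<integral>\<^sup>+x\<in>A. g x \<partial>M)"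
    and fin: "(\<integral>\<^sup>+x. g x \<partial>M) \<noteq> \<infinity>"
  shows "AE x in M. f x \<le> g x"
proof (rule ccontr)
  assume not: "\<not> (AE x in M. f x \<le> g x)"
  define A where "A = {x \<in> space M. g x < f x}"
  have [measurable]: "A \<in> sets M" unfolding A_def by measurable
  have "(\<integral>\<^sup>+x. g x * indicator A x \<partial>M) < (\<integral>\<^sup>+x. f x * indicator A x \<partial>M)"
  proof (rule nn_integral_less)
    have "(\<integral>\<^sup>+x. g x * indicator A x \<partial>M) \<le> (\<integral>\<^sup>+x. g x \<partial>M)"
      by (intro nn_integral_mono) (simp add: indicator_def)
    with fin show "(\<integral>\<^sup>+x. g x * indicator A x \<partial>M) \<noteq> \<infinity>"
      by (auto simp: top_unique)
    show "AE x in M. g x * indicator A x \<le> f x * indicator A x"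
      by (auto simp: A_def indicator_def intro: less_imp_le)
    show "\<not> (AE x in M. f x * indicator A x \<le> g x * indicator A x)"
    proof
      assume "AE x in M. f x * indicator A x \<le> g x * indicator A x"
      then have "AE x in M. f x \<le> g x"
        using AE_space
      proof eventually_elim
        case (elim x)
        then show ?case by (cases "x \<in> A") (auto simp: A_def)
      qed
      with not show False ..
    qed
  qed measurable
  with le[of A] show False by simp
qed

abbreviation unit_uniform :: "real measure" where
  "unit_uniform \<equiv> uniform_measure lborel {0..1}"

lemma prob_space_unit_uniform: "prob_space unit_uniform"
  by (rule prob_space_uniform_measure) auto

lemma emeasure_unit_uniform_less:
  fixes c :: ennreal
  assumes "c \<le> 1"
  shows "emeasure unit_uniform {u. ennreal u < c} = c"
proof -
  have "c < top" using assms by (rule le_less_trans) simp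
  then obtain a where a: "c = ennreal a" "0 \<le> a" by (cases c) auto
  then have "a \<le> 1" using assms by simp
  have "{0..1} \<inter> {u. ennreal u < c} = {0..<a}"
    using a \<open>a \<le> 1\<close> by (auto simp: ennreal_less_iff)
  then have "emeasure lborel ({0..1} \<inter> {u. ennreal u < c}) = c"
    using a by simp
  then show ?thesis
    by (simp add: emeasure_uniform_measure divide_ennreal_def)
qed

text \<open>
  Disintegration over a coded target. For a level \<open>r\<close>, a Radon-Nikodym density \<open>F r\<close> of
  \<open>A \<mapsto> s (A \<times> {y. r < f y})\<close> with respect to \<open>p\<close> is the conditional tail probability of the code
  \<open>f y\<close> given \<open>x\<close>. For rational levels these are simultaneously, for almost every \<open>x\<close>, decreasing in \<open>r\<close>
  and at most 1. Their generalised inverse \<open>Q x u\<close>, evaluated at a uniformly distributed \<open>u\<close>, has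
  exactly these tail probabilities, so \<open>L (Q x u)\<close> has the conditional law of \<open>y\<close>. Sampling through \<open>Q\<close>
  makes every \<open>K x\<close> a probability measure, also on the null set of \<open>x\<close> where \<open>F\<close> misbehaves, and makes
  \<open>K\<close> measurable because \<open>Q\<close> is jointly measurable.
\<close>

theorem kernel_exists:
  assumes s: "s \<in> space (prob_algebra (p \<Otimes>\<^sub>M q))" and marg: "distr s p fst = p"
    and coding: "real_coding q f L"
  shows "\<exists>K. K \<in> p \<rightarrow>\<^sub>M prob_algebra q \<and>
     (\<forall>A\<in>sets p. \<forall>B\<in>sets q. (\<integral>\<^sup>+x\<in>A. emeasure (K x) B \<partial>p) = emeasure s (A \<times> B))"
proof -
  have sets_s[measurable_cong]: "sets s = sets (p \<Otimes>\<^sub>M q)" and "prob_space s"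
    using s by (auto simp: space_prob_algebra)
  interpret s: prob_space s by fact
  interpret p: prob_space p
    using s.prob_space_distr[of fst p] by (simp add: marg)
  have [measurable]: "f \<in> borel_measurable q" "L \<in> borel \<rightarrow>\<^sub>M q"
    and f_code: "\<And>y. y \<in> space q \<Longrightarrow> 0 \<le> f y \<and> f y < 1 \<and> L (f y) = y"
    using coding by (auto simp: real_coding_def)
  have space_s: "space s = space p \<times> space q"
    using sets_eq_imp_space_eq[OF sets_s] by (simp add: space_pair_measure)
  define H where "H r = {y \<in> space q. r < f y}" for r
  have [measurable]: "H r \<in> sets q" for r unfolding H_def by measurable

  have "\<exists>F. F \<in> borel_measurable p \<and>
     (\<forall>A\<in>sets p. (\<integral>\<^sup>+x\<in>A. F x \<partial>p) = emeasure s (A \<times> H r))" for r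
  proof -
    define \<nu> where "\<nu> = distr (density s (indicator (space p \<times> H r))) p fst"
    have \<nu>: "emeasure \<nu> A = emeasure s (A \<times> H r)" if [measurable]: "A \<in> sets p" for A
    proof -
      have "emeasure \<nu> A = (\<integral>\<^sup>+z. indicator (space p \<times> H r) z * indicator (fst -` A \<inter> space s) z \<partial>s)"
        unfolding \<nu>_def by (subst emeasure_distr) (simp_all add: emeasure_density)
      also have "\<dots> = (\<integral>\<^sup>+z. indicator (A \<times> H r) z \<partial>s)"
        using sets.sets_into_space[OF that]
        by (intro nn_integral_cong) (auto simp: indicator_def space_s)
      finally show ?thesis by simp
    qed
    have "absolutely_continuous p \<nu>"
      unfolding absolutely_continuous_def
    proof
      fix A assume A: "A \<in> null_sets p"
      then have [measurable]: "A \<in> sets p" by auto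
      have "emeasure s (A \<times> H r) \<le> emeasure s (fst -` A \<inter> space s)"
        using sets.sets_into_space[OF \<open>A \<in> sets p\<close>] sets.sets_into_space[of "H r" q]
        by (intro emeasure_mono) (auto simp: space_s)
      also have "\<dots> = emeasure (distr s p fst) A"
        by (subst emeasure_distr) auto
      also have "\<dots> = 0" using A by (simp add: marg null_setsD1)
      finally show "A \<in> null_sets \<nu>"
        by (simp add: null_sets_def \<nu>) (simp add: \<nu>_def)
    qed
    then obtain F where "F \<in> borel_measurable p" "density p F = \<nu>"
      using p.Radon_Nikodym[of \<nu>] by (auto simp: \<nu>_def)
    then show ?thesis
      by (intro exI[of _ F]) (simp add: \<nu>[symmetric] emeasure_density[symmetric])
  qed
  then obtain F where [measurable]: "\<And>r. F r \<in> borel_measurable p"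
    and F: "\<And>r A. A \<in> sets p \<Longrightarrow> (\<integral>\<^sup>+x\<in>A. F r x \<partial>p) = emeasure s (A \<times> H r)"
    by metis

  let ?R = "\<rat> \<inter> {0..1::real}"
  have "AE x in p. F r x \<le> 1" for r
  proof (rule AE_le_of_set_nn_integral_le)
    fix A assume [measurable]: "A \<in> sets p"
    have "emeasure s (A \<times> H r) \<le> emeasure s (fst -` A \<inter> space s)"
      using sets.sets_into_space[OF \<open>A \<in> sets p\<close>] sets.sets_into_space[of "H r" q]
      by (intro emeasure_mono) (auto simp: space_s)
    also have "\<dots> = emeasure (distr s p fst) A"
      by (subst emeasure_distr) auto
    finally show "(\<integral>\<^sup>+x\<in>A. F r x \<partial>p) \<le> (\<integral>\<^sup>+x\<in>A. 1 \<partial>p)"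
      by (simp add: F marg)
  qed (auto simp: p.emeasure_space_1)
  moreover have "AE x in p. F r' x \<le> F r x" if "r \<le> r'" for r r'
  proof (rule AE_le_of_set_nn_integral_le)
    fix A assume [measurable]: "A \<in> sets p"
    show "(\<integral>\<^sup>+x\<in>A. F r' x \<partial>p) \<le> (\<integral>\<^sup>+x\<in>A. F r x \<partial>p)"
      unfolding F[OF \<open>A \<in> sets p\<close>] using that by (intro emeasure_mono) (auto simp: H_def)
  next
    have "(\<integral>\<^sup>+x. F r x \<partial>p) = (\<integral>\<^sup>+x\<in>space p. F r x \<partial>p)"
      by (intro nn_integral_cong) simp
    also have "\<dots> = emeasure s (space p \<times> H r)" by (rule F) simp
    finally show "(\<integral>\<^sup>+x. F r x \<partial>p) \<noteq> \<infinity>" using s.emeasure_finite by simp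
  qed auto
  ultimately have "AE x in p. \<forall>r\<in>?R. F r x \<le> 1 \<and> (\<forall>r'\<in>?R. r \<le> r' \<longrightarrow> F r' x \<le> F r x)"
    by (intro AE_ball_countable[OF countable_levels, THEN iffD2] ballI AE_conjI) auto
  then have F_good: "AE x in p. \<forall>r\<in>?R. \<forall>r'\<in>?R. F r x \<le> 1 \<and> (r \<le> r' \<longrightarrow> F r' x \<le> F r x)"
    by eventually_elim auto

  define Q where "Q x u = level_sup (\<lambda>r. ennreal u < F r x)" for x and u :: real
  have Q_meas[measurable]: "(\<lambda>(x, u). Q x u) \<in> borel_measurable (p \<Otimes>\<^sub>M borel)"
    unfolding Q_def case_prod_beta by measurable
  interpret U: prob_space unit_uniform by (rule prob_space_unit_uniform)

  \<comment> \<open>The levels below 0 and from 1 on are trivial. In between, \<open>t < Q x u\<close> holds iff \<open>u < F r x\<close> for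
    some rational \<open>r > t\<close>, and monotone convergence along \<open>r \<down> t\<close> applies.\<close>
  have level: "(\<integral>\<^sup>+x\<in>A. emeasure unit_uniform {u. t < Q x u} \<partial>p) = emeasure s (A \<times> H t)"
    if [measurable]: "A \<in> sets p" for A t
  proof -
    consider "t < 0" | "1 \<le> t" | "0 \<le> t" "t < 1" by linarith
    then show ?thesis
    proof cases
      case 1
      then have "{u. t < Q x u} = UNIV" for x
        using level_sup_nonneg by (auto simp: Q_def intro: less_le_trans)
      moreover have "emeasure unit_uniform UNIV = 1"
        using U.emeasure_space_1 by simp
      moreover have "A \<times> H t = fst -` A \<inter> space s"
        using f_code 1 sets.sets_into_space[OF that] by (force simp: H_def space_s)
      moreover have "emeasure s (fst -` A \<inter> space s) = emeasure p A"
        using emeasure_distr[of fst s p A] by (simp add: marg)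
      ultimately show ?thesis by simp
    next
      case 2
      then have "{u. t < Q x u} = {}" for x
        unfolding Q_def using level_sup_gt[of t] by auto
      moreover have "H t = {}" using f_code 2 by (force simp: H_def)
      ultimately show ?thesis by simp
    next
      case 3
      obtain r where r: "\<And>n. r n \<in> ?R" "\<And>n. t < r n" "decseq r" "r \<longlonglongrightarrow> t"
        using rational_decseq[OF 3] by metis
      have "AE x in p. emeasure unit_uniform {u. t < Q x u} = (SUP n. F (r n) x)"
        using F_good
      proof eventually_elim
        case (elim x)
        have "{u. t < Q x u} = (\<Union>n. {u. ennreal u < F (r n) x})"
        proof (intro set_eqI iffI)
          fix u assume "u \<in> {u. t < Q x u}"
          then obtain r' where r': "r' \<in> ?R" "t < r'" "ennreal u < F r' x"
            unfolding Q_def using level_sup_gt[OF 3(1)] by auto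
          obtain n where "r n < r'"
            using order_tendstoD(2)[OF r(4) r'(2)] by (auto simp: eventually_sequentially)
          then have "F r' x \<le> F (r n) x" using elim r(1)[of n] r'(1) by auto
          with r'(3) show "u \<in> (\<Union>n. {u. ennreal u < F (r n) x})"
            using less_le_trans by blast
        next
          fix u assume "u \<in> (\<Union>n. {u. ennreal u < F (r n) x})"
          then obtain n where "ennreal u < F (r n) x" by blast
          then have "\<exists>r\<in>?R. t < r \<and> ennreal u < F r x"
            using r(1,2) by blast
          then show "u \<in> {u. t < Q x u}"
            unfolding Q_def using level_sup_gt[OF 3(1)] by blast
        qed
        also have "emeasure unit_uniform \<dots> = (SUP n. emeasure unit_uniform {u. ennreal u < F (r n) x})"
        proof (rule SUP_emeasure_incseq[symmetric])
          show "range (\<lambda>n. {u. ennreal u < F (r n) x}) \<subseteq> sets unit_uniform"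
            by auto
          show "incseq (\<lambda>n. {u. ennreal u < F (r n) x})"
          proof (intro monoI subsetI)
            fix m n :: nat and u assume "m \<le> n" "u \<in> {u. ennreal u < F (r m) x}"
            moreover have "r n \<le> r m" using r(3) \<open>m \<le> n\<close> by (rule decseqD)
            ultimately show "u \<in> {u. ennreal u < F (r n) x}"
              using elim r(1) by (auto intro: less_le_trans)
          qed
        qed
        also have "\<dots> = (SUP n. F (r n) x)"
        proof (intro SUP_cong refl emeasure_unit_uniform_less)
          show "F (r n) x \<le> 1" for n using elim r(1)[of n] by blast
        qed
        finally show ?case .
      qed
      then have "AE x in p. emeasure unit_uniform {u. t < Q x u} * indicator A x = (SUP n. F (r n) x * indicator A x)"
        by eventually_elim (simp add: SUP_mult_right_ennreal)
      then have "(\<integral>\<^sup>+x\<in>A. emeasure unit_uniform {u. t < Q x u} \<partial>p) = (\<integral>\<^sup>+x. (SUP n. F (r n) x * indicator A x) \<partial>p)"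
        by (rule nn_integral_cong_AE)
      also have "\<dots> = (SUP n. \<integral>\<^sup>+x\<in>A. F (r n) x \<partial>p)"
      proof (rule nn_integral_monotone_convergence_SUP_AE)
        show "AE x in p. F (r n) x * indicator A x \<le> F (r (Suc n)) x * indicator A x" for n
          using F_good
        proof eventually_elim
          case (elim x)
          have "r (Suc n) \<le> r n" using r(3) by (auto intro: decseqD)
          then show ?case using elim r(1) by (intro mult_right_mono) auto
        qed
      qed measurable
      also have "\<dots> = (SUP n. emeasure s (A \<times> H (r n)))"
        by (simp add: F)
      also have "\<dots> = emeasure s (\<Union>n. A \<times> H (r n))"
      proof (rule SUP_emeasure_incseq)
        show "incseq (\<lambda>n. A \<times> H (r n))"
          using decseqD[OF r(3)] by (intro monoI) (force simp: H_def)
      qed auto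
      also have "(\<Union>n. A \<times> H (r n)) = A \<times> H t"
      proof -
        have "\<exists>n. r n < f y" if "t < f y" for y
          using order_tendstoD(2)[OF r(4) that] by (auto simp: eventually_sequentially)
        then show ?thesis using r(2) by (fastforce simp: H_def intro: less_trans)
      qed
      finally show ?thesis .
    qed
  qed

  define K where "K x = distr unit_uniform q (\<lambda>u. L (Q x u))" for x
  have Qx[measurable]: "Q x \<in> borel_measurable borel" if "x \<in> space p" for x
    using measurable_Pair2[OF Q_meas that] by simp
  have K_meas: "K \<in> p \<rightarrow>\<^sub>M prob_algebra q"
    unfolding K_def
  proof (rule measurable_distr_prob_space2)
    show "(\<lambda>x. unit_uniform) \<in> p \<rightarrow>\<^sub>M prob_algebra borel"
      by (rule measurable_const) (simp add: space_prob_algebra U.prob_space_axioms)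
  qed measurable
  have "(\<integral>\<^sup>+x\<in>A. emeasure (K x) B \<partial>p) = emeasure s (A \<times> B)"
    if [measurable]: "A \<in> sets p" "B \<in> sets q" for A B
  proof -
    \<comment> \<open>For fixed \<open>A\<close>, the laws of the code under \<open>s\<close> and of \<open>Q\<close> under \<open>p\<close> times uniform, both restricted
      to \<open>x \<in> A\<close>, are finite measures on the line with equal tails.\<close>
    let ?m1 = "distr (density s (indicator (A \<times> space q))) borel (\<lambda>z. f (snd z))"
    let ?m2 = "distr (density (p \<Otimes>\<^sub>M unit_uniform) (indicator (A \<times> UNIV))) borel (\<lambda>(x, u). Q x u)"
    have Q_meas'[measurable]: "(\<lambda>(x, u). Q x u) \<in> borel_measurable (p \<Otimes>\<^sub>M unit_uniform)"
      using Q_meas by (simp cong: measurable_cong_sets)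
    have m1: "emeasure ?m1 D = emeasure s (A \<times> {y \<in> space q. f y \<in> D})" if [measurable]: "D \<in> sets borel" for D
    proof -
      have "emeasure ?m1 D = (\<integral>\<^sup>+z. indicator (A \<times> space q) z * indicator ((\<lambda>z. f (snd z)) -` D \<inter> space s) z \<partial>s)"
        by (subst emeasure_distr) (simp_all add: emeasure_density)
      also have "\<dots> = (\<integral>\<^sup>+z. indicator (A \<times> {y \<in> space q. f y \<in> D}) z \<partial>s)"
        using sets.sets_into_space[OF \<open>A \<in> sets p\<close>]
        by (intro nn_integral_cong) (auto simp: indicator_def space_s)
      finally show ?thesis by simp
    qed
    have m2: "emeasure ?m2 D = (\<integral>\<^sup>+x\<in>A. emeasure unit_uniform {u. Q x u \<in> D} \<partial>p)"
      if [measurable]: "D \<in> sets borel" for D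
    proof -
      have "emeasure ?m2 D = (\<integral>\<^sup>+z. indicator (A \<times> UNIV) z * indicator ((\<lambda>(x, u). Q x u) -` D \<inter> space (p \<Otimes>\<^sub>M unit_uniform)) z \<partial>(p \<Otimes>\<^sub>M unit_uniform))"
        using measurable_sets[OF Q_meas' that]
        by (subst emeasure_distr) (simp_all add: emeasure_density)
      also have "\<dots> = (\<integral>\<^sup>+x. \<integral>\<^sup>+u. indicator (A \<times> UNIV) (x, u) * indicator ((\<lambda>(x, u). Q x u) -` D \<inter> space (p \<Otimes>\<^sub>M unit_uniform)) (x, u) \<partial>unit_uniform \<partial>p)"
        using measurable_sets[OF Q_meas' that] by (subst U.nn_integral_fst[symmetric]) auto
      also have "\<dots> = (\<integral>\<^sup>+x\<in>A. emeasure unit_uniform {u. Q x u \<in> D} \<partial>p)"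
      proof (rule nn_integral_cong)
        fix x assume x: "x \<in> space p"
        have [measurable]: "{u. Q x u \<in> D} \<in> sets borel"
          using measurable_sets[OF Qx[OF x] that] by (simp add: vimage_def)
        have "(\<integral>\<^sup>+u. indicator (A \<times> UNIV) (x, u) * indicator ((\<lambda>(x, u). Q x u) -` D \<inter> space (p \<Otimes>\<^sub>M unit_uniform)) (x, u) \<partial>unit_uniform)
          = (\<integral>\<^sup>+u. indicator {u. Q x u \<in> D} u * indicator A x \<partial>unit_uniform)"
          using x by (intro nn_integral_cong) (auto simp: indicator_def space_pair_measure)
        also have "\<dots> = emeasure unit_uniform {u. Q x u \<in> D} * indicator A x"
          by (subst nn_integral_multc) auto
        finally show "(\<integral>\<^sup>+u. indicator (A \<times> UNIV) (x, u) * indicator ((\<lambda>(x, u). Q x u) -` D \<inter> space (p \<Otimes>\<^sub>M unit_uniform)) (x, u) \<partial>unit_uniform)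
          = emeasure unit_uniform {u. Q x u \<in> D} * indicator A x" .
      qed
      finally show ?thesis .
    qed
    have "?m1 = ?m2"
    proof (rule measure_eqI_lessThan)
      show "emeasure ?m1 {t<..} < \<infinity>" for t
        by (subst m1) (auto simp: less_top[symmetric])
      show "emeasure ?m1 {t<..} = emeasure ?m2 {t<..}" for t
        by (subst m1, simp, subst m2, simp) (simp add: level H_def)
    qed auto
    moreover define D where "D = L -` B \<inter> space borel"
    moreover have [measurable]: "D \<in> sets borel"
      unfolding D_def by measurable
    ultimately have "(\<integral>\<^sup>+x\<in>A. emeasure unit_uniform {u. Q x u \<in> D} \<partial>p) = emeasure s (A \<times> {y \<in> space q. f y \<in> D})"
      using m1[of D] m2[of D] by simp
    also have "{y \<in> space q. f y \<in> D} = B"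
      using f_code sets.sets_into_space[OF \<open>B \<in> sets q\<close>] by (auto simp: D_def)
    also have "(\<integral>\<^sup>+x\<in>A. emeasure unit_uniform {u. Q x u \<in> D} \<partial>p) = (\<integral>\<^sup>+x\<in>A. emeasure (K x) B \<partial>p)"
    proof (rule nn_integral_cong)
      fix x assume x: "x \<in> space p"
      then have [measurable]: "Q x \<in> borel_measurable borel" by (rule Qx)
      have "emeasure (K x) B = emeasure unit_uniform {u. Q x u \<in> D}"
        unfolding K_def by (subst emeasure_distr) (auto simp: D_def vimage_def)
      then show "emeasure unit_uniform {u. Q x u \<in> D} * indicator A x = emeasure (K x) B * indicator A x"
        by simp
    qed
    finally show ?thesis .
  qed
  with K_meas show ?thesis by blast
qed

section \<open>Joint laws and their kernels\<close>

lemma measure_eqI_rectangles: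
  assumes sets: "sets M = sets (p \<Otimes>\<^sub>M q)" "sets N = sets (p \<Otimes>\<^sub>M q)"
    and fin: "finite_measure M"
    and eq: "\<And>A B. A \<in> sets p \<Longrightarrow> B \<in> sets q \<Longrightarrow> emeasure M (A \<times> B) = emeasure N (A \<times> B)"
  shows "M = N"
proof (rule measure_eqI_generator_eq[OF Int_stable_pair_measure_generator[of p q],
      where \<Omega> = "space p \<times> space q" and A = "\<lambda>_. space p \<times> space q"])
  show "emeasure M (space p \<times> space q) \<noteq> \<infinity>"
    using finite_measure.emeasure_finite[OF fin] by simp
  show "{a \<times> b |a b. a \<in> sets p \<and> b \<in> sets q} \<subseteq> Pow (space p \<times> space q)"
    by (auto dest: sets.sets_into_space)
qed (use sets eq in \<open>auto simp: sets_pair_measure\<close>)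

lemma measure_by_rectangles_eq:
  assumes "sets u = sets (p \<Otimes>\<^sub>M r)" "finite_measure u"
    and "\<And>A C. A \<in> sets p \<Longrightarrow> C \<in> sets r \<Longrightarrow> emeasure u (A \<times> C) = \<phi> A C"
  shows "measure_by_rectangles p r \<phi> = u"
  unfolding measure_by_rectangles_def
proof (rule the_equality)
  fix v assume "sets v = sets (p \<Otimes>\<^sub>M r) \<and> (\<forall>A\<in>sets p. \<forall>C\<in>sets r. emeasure v (A \<times> C) = \<phi> A C)"
  then show "v = u"
    using assms by (intro measure_eqI_rectangles[symmetric, of _ p r]) auto
qed (use assms in auto)

text \<open>
  The semidirect product of \<open>p\<close> and \<open>K\<close>.
\<close>

definition kernel_pair :: "'a measure \<Rightarrow> 'b measure \<Rightarrow> ('a \<Rightarrow> 'b measure) \<Rightarrow> ('a \<times> 'b) measure" where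
  "kernel_pair p q K = p \<bind> (\<lambda>x. distr (K x) (p \<Otimes>\<^sub>M q) (Pair x))"

context
  fixes p :: "'a measure" and q :: "'b measure" and K :: "'a \<Rightarrow> 'b measure"
  assumes p: "prob_space p" and K[measurable]: "K \<in> p \<rightarrow>\<^sub>M prob_algebra q"
begin

lemma prob_space_in_prob_algebra: "p \<in> space (prob_algebra p)"
  using p by (simp add: space_prob_algebra)

lemma kernel_sets: "x \<in> space p \<Longrightarrow> sets (K x) = sets q"
  using measurable_space[OF K] by (simp add: space_prob_algebra)

lemma measurable_section: "(\<lambda>x. distr (K x) (p \<Otimes>\<^sub>M q) (Pair x)) \<in> p \<rightarrow>\<^sub>M prob_algebra (p \<Otimes>\<^sub>M q)"
  by measurable

lemma kernel_pair_space: "kernel_pair p q K \<in> space (prob_algebra (p \<Otimes>\<^sub>M q))"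
  unfolding kernel_pair_def space_prob_algebra
  using prob_space_bind'[OF prob_space_in_prob_algebra measurable_section] sets_bind'[OF prob_space_in_prob_algebra measurable_section]
  by simp

lemma nn_integral_kernel_pair:
  assumes [measurable]: "h \<in> borel_measurable (p \<Otimes>\<^sub>M q)"
  shows "(\<integral>\<^sup>+z. h z \<partial>kernel_pair p q K) = (\<integral>\<^sup>+x. \<integral>\<^sup>+y. h (x, y) \<partial>K x \<partial>p)"
proof -
  have "(\<integral>\<^sup>+z. h z \<partial>kernel_pair p q K) = (\<integral>\<^sup>+x. \<integral>\<^sup>+z. h z \<partial>distr (K x) (p \<Otimes>\<^sub>M q) (Pair x) \<partial>p)"
    unfolding kernel_pair_def
    by (rule nn_integral_bind[OF assms measurable_prob_algebraD[OF measurable_section]])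
  also have "\<dots> = (\<integral>\<^sup>+x. \<integral>\<^sup>+y. h (x, y) \<partial>K x \<partial>p)"
  proof (rule nn_integral_cong)
    fix x assume x: "x \<in> space p"
    have "Pair x \<in> K x \<rightarrow>\<^sub>M p \<Otimes>\<^sub>M q"
      using x by (simp add: measurable_cong_sets[OF kernel_sets[OF x] refl])
    then show "(\<integral>\<^sup>+z. h z \<partial>distr (K x) (p \<Otimes>\<^sub>M q) (Pair x)) = (\<integral>\<^sup>+y. h (x, y) \<partial>K x)"
      by (subst nn_integral_distr) simp_all
  qed
  finally show ?thesis .
qed

lemma emeasure_kernel_pair_Times:
  assumes [measurable]: "A \<in> sets p" "B \<in> sets q"
  shows "emeasure (kernel_pair p q K) (A \<times> B) = (\<integral>\<^sup>+x\<in>A. emeasure (K x) B \<partial>p)"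
proof -
  have "emeasure (kernel_pair p q K) (A \<times> B) = (\<integral>\<^sup>+z. indicator (A \<times> B) z \<partial>kernel_pair p q K)"
    using kernel_pair_space by (intro nn_integral_indicator[symmetric]) (auto simp: space_prob_algebra)
  also have "\<dots> = (\<integral>\<^sup>+x. \<integral>\<^sup>+y. indicator (A \<times> B) (x, y) \<partial>K x \<partial>p)"
    by (rule nn_integral_kernel_pair) measurable
  also have "\<dots> = (\<integral>\<^sup>+x\<in>A. emeasure (K x) B \<partial>p)"
  proof (rule nn_integral_cong)
    fix x assume x: "x \<in> space p"
    have "(\<integral>\<^sup>+y. indicator (A \<times> B) (x, y) \<partial>K x) = (\<integral>\<^sup>+y. indicator B y * indicator A x \<partial>K x)"
      by (intro nn_integral_cong) (auto simp: indicator_def)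
    also have "\<dots> = emeasure (K x) B * indicator A x"
      using kernel_sets[OF x] by (subst nn_integral_multc) auto
    finally show "(\<integral>\<^sup>+y. indicator (A \<times> B) (x, y) \<partial>K x) = emeasure (K x) B * indicator A x" .
  qed
  finally show ?thesis .
qed

end

definition disintegrates ::
    "'a measure \<Rightarrow> 'b measure \<Rightarrow> ('a \<times> 'b) measure \<Rightarrow> ('a \<Rightarrow> 'b measure) \<Rightarrow> bool" where
  "disintegrates p q s K \<longleftrightarrow> K \<in> p \<rightarrow>\<^sub>M prob_algebra q \<and>
     (\<forall>A\<in>sets p. \<forall>B\<in>sets q. (\<integral>\<^sup>+x\<in>A. emeasure (K x) B \<partial>p) = emeasure s (A \<times> B))"

lemma disintegrates_measurable: "disintegrates p q s K \<Longrightarrow> K \<in> p \<rightarrow>\<^sub>M prob_algebra q"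
  by (simp add: disintegrates_def)

lemma disintegrates_kernel_pair:
  assumes "prob_space p" "K \<in> p \<rightarrow>\<^sub>M prob_algebra q"
  shows "disintegrates p q (kernel_pair p q K) K"
  using assms by (simp add: disintegrates_def emeasure_kernel_pair_Times)

lemma disintegrates_imp_eq_kernel_pair:
  assumes p: "prob_space p" and s: "sets s = sets (p \<Otimes>\<^sub>M q)" and K: "disintegrates p q s K"
  shows "s = kernel_pair p q K"
proof (rule measure_eqI_rectangles[symmetric])
  note K' = disintegrates_measurable[OF K]
  show "sets (kernel_pair p q K) = sets (p \<Otimes>\<^sub>M q)" "finite_measure (kernel_pair p q K)"
    using kernel_pair_space[OF p K'] by (auto simp: space_prob_algebra prob_space.finite_measure)
  show "emeasure (kernel_pair p q K) (A \<times> B) = emeasure s (A \<times> B)" if "A \<in> sets p" "B \<in> sets q" for A B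
    using emeasure_kernel_pair_Times[OF p K' that] K that by (simp add: disintegrates_def)
qed fact

text \<open>
  The defining identity on rectangles determines \<open>s\<close>, hence extends to a Fubini formula for arbitrary
  integrands.
\<close>

lemma nn_integral_disintegrates:
  assumes "prob_space p" "sets s = sets (p \<Otimes>\<^sub>M q)" "disintegrates p q s K"
    and "h \<in> borel_measurable (p \<Otimes>\<^sub>M q)"
  shows "(\<integral>\<^sup>+z. h z \<partial>s) = (\<integral>\<^sup>+x. \<integral>\<^sup>+y. h (x, y) \<partial>K x \<partial>p)"
  unfolding disintegrates_imp_eq_kernel_pair[OF assms(1-3)]
  by (rule nn_integral_kernel_pair[OF assms(1) disintegrates_measurable[OF assms(3)] assms(4)])

text \<open>
  Equations between couplings are proved by comparing kernels.
\<close>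

lemma disintegrates_unique:
  assumes p: "prob_space p" and s: "sets s = sets (p \<Otimes>\<^sub>M q)" "sets s' = sets (p \<Otimes>\<^sub>M q)"
    and K: "disintegrates p q s K" "disintegrates p q s' K'"
    and eq: "\<And>x. x \<in> space p \<Longrightarrow> K x = K' x"
  shows "s = s'"
proof -
  have "kernel_pair p q K = kernel_pair p q K'"
    unfolding kernel_pair_def by (rule bind_cong) (simp_all add: eq)
  then show ?thesis
    using disintegrates_imp_eq_kernel_pair[OF p s(1) K(1)] disintegrates_imp_eq_kernel_pair[OF p s(2) K(2)]
    by simp
qed

section \<open>Couplings as kernels\<close>

lemma couplingsD:
  assumes "s \<in> couplings p q"
  shows "prob_space s" "sets s = sets (p \<Otimes>\<^sub>M q)" "distr s p fst = p" "distr s q snd = q"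
    "s \<in> space (prob_algebra (p \<Otimes>\<^sub>M q))"
    "space s = space p \<times> space q"
  using assms sets_eq_imp_space_eq[of s "p \<Otimes>\<^sub>M q"]
  by (auto simp: couplings_def space_prob_algebra space_pair_measure)

lemma coupling_swap:
  assumes s: "s \<in> couplings p q"
  shows "distr s (q \<Otimes>\<^sub>M p) (\<lambda>(x, y). (y, x)) \<in> couplings q p"
proof -
  note [measurable_cong] = couplingsD(2)[OF s]
  interpret prob_space s by (rule couplingsD(1)[OF s])
  show ?thesis
    using couplingsD(3,4)[OF s]
    by (auto simp: couplings_def space_prob_algebra distr_distr comp_def case_prod_beta intro!: prob_space_distr)
qed

lemma coupling_prob_space:
  assumes s: "s \<in> couplings p q"
  shows "prob_space p" "prob_space q"
proof -
  note [measurable_cong] = couplingsD(2)[OF s]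
  interpret prob_space s by (rule couplingsD(1)[OF s])
  show "prob_space p" "prob_space q"
    using prob_space_distr[of fst p] prob_space_distr[of snd q] couplingsD(3,4)[OF s] by auto
qed

lemma coupling_disintegration_exists:
  assumes s: "s \<in> couplings p q" and q: "standard_borel q"
  shows "\<exists>K. disintegrates p q s K"
proof -
  have "space q \<noteq> {}" using coupling_prob_space(2)[OF s] by (rule prob_space.not_empty)
  then obtain f L where "real_coding q f L" using standard_borel_real_coding[OF q] by blast
  then show ?thesis
    using kernel_exists[OF couplingsD(5)[OF s] couplingsD(3)[OF s]] by (simp add: disintegrates_def)
qed

lemma forward_kernel_disintegrates:
  assumes "s \<in> couplings p q" "standard_borel q"
  shows "disintegrates p q s (forward_kernel p q s)"
  using someI_ex[OF coupling_disintegration_exists[OF assms]]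
  by (simp add: forward_kernel_def disintegrates_def)

lemma backward_kernel_disintegrates:
  assumes s: "s \<in> couplings p q" and p: "standard_borel p"
  shows "disintegrates q p (distr s (q \<Otimes>\<^sub>M p) (\<lambda>(x, y). (y, x))) (backward_kernel p q s)"
proof -
  note [measurable_cong] = couplingsD(2)[OF s]
  have swap: "emeasure (distr s (q \<Otimes>\<^sub>M p) (\<lambda>(x, y). (y, x))) (B \<times> A) = emeasure s (A \<times> B)"
    if [measurable]: "A \<in> sets p" "B \<in> sets q" for A B
    using sets.sets_into_space[OF that(1)] sets.sets_into_space[OF that(2)]
    by (subst emeasure_distr) (auto simp: couplingsD(6)[OF s] intro!: arg_cong[where f = "emeasure s"])
  have "disintegrates q p (distr s (q \<Otimes>\<^sub>M p) (\<lambda>(x, y). (y, x))) K \<longleftrightarrow>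
    K \<in> q \<rightarrow>\<^sub>M prob_algebra p \<and>
     (\<forall>A\<in>sets p. \<forall>B\<in>sets q. (\<integral>\<^sup>+y\<in>B. emeasure (K y) A \<partial>q) = emeasure s (A \<times> B))" for K
    unfolding disintegrates_def using swap by auto
  with someI_ex[OF coupling_disintegration_exists[OF coupling_swap[OF s] p]] show ?thesis
    by (simp add: backward_kernel_def)
qed

lemma nn_integral_coupling_snd:
  assumes s: "s \<in> couplings p q" and [measurable]: "g \<in> borel_measurable q"
  shows "(\<integral>\<^sup>+z. g (snd z) \<partial>s) = (\<integral>\<^sup>+y. g y \<partial>q)"
proof -
  note [measurable_cong] = couplingsD(2)[OF s]
  have "(\<integral>\<^sup>+y. g y \<partial>distr s q snd) = (\<integral>\<^sup>+z. g (snd z) \<partial>s)"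
    by (rule nn_integral_distr) measurable
  then show ?thesis by (simp add: couplingsD(4)[OF s])
qed

text \<open>
  Composition of couplings is composition of kernels. On a rectangle \<open>A \<times> C\<close> both sides are the
  integral over \<open>s\<close> of \<open>indicator A x * emeasure (L y) C\<close>: the left one after disintegrating \<open>s\<close>
  backwards, the right one after disintegrating it forwards. The forward kernel chosen in the
  definition may differ from \<open>L\<close> on a null set; integrating against \<open>t\<close>
  shows that the exchange does not change the integral.
\<close>

theorem compose_couplings_kernel:
  assumes s: "s \<in> couplings p q" and t: "t \<in> couplings q r"
    and sb: "standard_borel p" "standard_borel r"
    and K: "disintegrates p q s K" and L: "disintegrates q r t L"
  shows "compose_couplings p q r t s \<in> couplings p r"
    and "disintegrates p r (compose_couplings p q r t s) (\<lambda>x. K x \<bind> L)"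
proof -
  define u where "u = kernel_pair p r (\<lambda>x. K x \<bind> L)"
  note p = coupling_prob_space(1)[OF s] and q = coupling_prob_space(2)[OF s]
  note [measurable_cong] = couplingsD(2)[OF s] couplingsD(2)[OF t]
  have K'[measurable]: "K \<in> p \<rightarrow>\<^sub>M prob_algebra q" and L'[measurable]: "L \<in> q \<rightarrow>\<^sub>M prob_algebra r"
    using K L by (auto simp: disintegrates_def)
  have KL[measurable]: "(\<lambda>x. K x \<bind> L) \<in> p \<rightarrow>\<^sub>M prob_algebra r"
    by (rule measurable_bind_prob_space[OF K' L'])
  have u: "u \<in> space (prob_algebra (p \<Otimes>\<^sub>M r))"
    unfolding u_def by (rule kernel_pair_space[OF p KL])
  have L_meas[measurable]: "(\<lambda>y. emeasure (L y) C) \<in> borel_measurable q" if "C \<in> sets r" for C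
    using measurable_compose[OF measurable_prob_algebraD[OF L'] measurable_emeasure_subprob_algebra[OF that]] .
  have u_s: "emeasure u (A \<times> C) = (\<integral>\<^sup>+z. indicator A (fst z) * emeasure (L (snd z)) C \<partial>s)"
    if [measurable]: "A \<in> sets p" "C \<in> sets r" for A C
  proof -
    have "emeasure u (A \<times> C) = (\<integral>\<^sup>+x\<in>A. emeasure (K x \<bind> L) C \<partial>p)"
      unfolding u_def by (rule emeasure_kernel_pair_Times[OF p KL that])
    also have "\<dots> = (\<integral>\<^sup>+x. \<integral>\<^sup>+y. indicator A x * emeasure (L y) C \<partial>K x \<partial>p)"
    proof (rule nn_integral_cong)
      fix x assume "x \<in> space p"
      then have Kx: "K x \<in> space (prob_algebra q)" by (rule measurable_space[OF K'])
      then have "sets (K x) = sets q" by (simp add: space_prob_algebra)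
      then have "(\<lambda>y. emeasure (L y) C) \<in> borel_measurable (K x)"
        using L_meas[OF that(2)] by (simp cong: measurable_cong_sets)
      then show "emeasure (K x \<bind> L) C * indicator A x = (\<integral>\<^sup>+y. indicator A x * emeasure (L y) C \<partial>K x)"
        by (simp add: emeasure_bind_prob_algebra[OF Kx L' that(2)] nn_integral_cmult mult.commute)
    qed
    also have "\<dots> = (\<integral>\<^sup>+z. indicator A (fst z) * emeasure (L (snd z)) C \<partial>s)"
      by (subst nn_integral_disintegrates[OF p couplingsD(2)[OF s] K]) simp_all
    finally show ?thesis .
  qed
  let ?kb = "backward_kernel p q s" and ?kf = "forward_kernel q r t"
  let ?s' = "distr s (q \<Otimes>\<^sub>M p) (\<lambda>(x, y). (y, x))"
  note kb = backward_kernel_disintegrates[OF s sb(1)]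
  note kf = forward_kernel_disintegrates[OF t sb(2)]
  have kb'[measurable]: "?kb \<in> q \<rightarrow>\<^sub>M prob_algebra p" using kb by (simp add: disintegrates_def)
  have kf'[measurable]: "?kf \<in> q \<rightarrow>\<^sub>M prob_algebra r" using kf by (simp add: disintegrates_def)
  have kb_meas[measurable]: "(\<lambda>y. emeasure (?kb y) A) \<in> borel_measurable q" if "A \<in> sets p" for A
    using measurable_compose[OF measurable_prob_algebraD[OF kb'] measurable_emeasure_subprob_algebra[OF that]] .
  \<comment> \<open>The left-hand side is the same for every disintegration \<open>M\<close> of \<open>t\<close>, as the right-hand side does
    not mention \<open>M\<close>.\<close>
  have any_forward: "(\<integral>\<^sup>+y. g y * emeasure (M y) C \<partial>q) = (\<integral>\<^sup>+z. g (fst z) * indicator C (snd z) \<partial>t)"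
    if M: "disintegrates q r t M" and [measurable]: "g \<in> borel_measurable q" "C \<in> sets r" for M g C
  proof -
    have "(\<integral>\<^sup>+z. g (fst z) * indicator C (snd z) \<partial>t) = (\<integral>\<^sup>+y. \<integral>\<^sup>+z. g y * indicator C z \<partial>M y \<partial>q)"
      by (subst nn_integral_disintegrates[OF q couplingsD(2)[OF t] M]) simp_all
    also have "\<dots> = (\<integral>\<^sup>+y. g y * emeasure (M y) C \<partial>q)"
      using that(3) kernel_sets[OF q disintegrates_measurable[OF M]]
      by (intro nn_integral_cong) (simp add: nn_integral_cmult_indicator)
    finally show ?thesis by simp
  qed
  have rect: "emeasure u (A \<times> C) = (\<integral>\<^sup>+y. emeasure (?kb y) A * emeasure (?kf y) C \<partial>q)"
    if [measurable]: "A \<in> sets p" "C \<in> sets r" for A C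
  proof -
    have "emeasure u (A \<times> C) = (\<integral>\<^sup>+z. indicator A (snd z) * emeasure (L (fst z)) C \<partial>?s')"
      unfolding u_s[OF that] by (subst nn_integral_distr) (simp_all add: case_prod_beta)
    also have "\<dots> = (\<integral>\<^sup>+y. \<integral>\<^sup>+x. indicator A x * emeasure (L y) C \<partial>?kb y \<partial>q)"
      by (subst nn_integral_disintegrates[OF q _ kb]) simp_all
    also have "\<dots> = (\<integral>\<^sup>+y. emeasure (?kb y) A * emeasure (L y) C \<partial>q)"
    proof (rule nn_integral_cong)
      fix y assume "y \<in> space q"
      then have A: "A \<in> sets (?kb y)" using kernel_sets[OF q kb'] that(1) by simp
      then show "(\<integral>\<^sup>+x. indicator A x * emeasure (L y) C \<partial>?kb y) = emeasure (?kb y) A * emeasure (L y) C"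
        by (simp add: nn_integral_multc[OF borel_measurable_indicator[OF A]])
    qed
    also have "\<dots> = (\<integral>\<^sup>+y. emeasure (?kb y) A * emeasure (?kf y) C \<partial>q)"
      by (simp add: any_forward[OF L] any_forward[OF kf])
    finally show ?thesis .
  qed
  have comp: "compose_couplings p q r t s = u"
    unfolding compose_couplings_def using u
    by (intro measure_by_rectangles_eq rect) (auto simp: space_prob_algebra prob_space.finite_measure)
  show "disintegrates p r (compose_couplings p q r t s) (\<lambda>x. K x \<bind> L)"
    unfolding comp u_def by (rule disintegrates_kernel_pair[OF p KL])
  have [measurable_cong]: "sets u = sets (p \<Otimes>\<^sub>M r)"
    using u by (simp add: space_prob_algebra)
  have space_u: "space u = space p \<times> space r"
    using sets_eq_imp_space_eq[OF \<open>sets u = _\<close>] by (simp add: space_pair_measure)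
  have "distr u p fst = p"
  proof (rule measure_eqI)
    fix A assume "A \<in> sets (distr u p fst)"
    then have [measurable]: "A \<in> sets p" by simp
    have "emeasure (distr u p fst) A = emeasure u (A \<times> space r)"
      using sets.sets_into_space[OF \<open>A \<in> sets p\<close>]
      by (subst emeasure_distr) (auto simp: space_u intro!: arg_cong[where f = "emeasure u"])
    also have "\<dots> = (\<integral>\<^sup>+x\<in>A. emeasure (K x \<bind> L) (space r) \<partial>p)"
      unfolding u_def by (rule emeasure_kernel_pair_Times[OF p KL]) auto
    also have "\<dots> = (\<integral>\<^sup>+x\<in>A. 1 \<partial>p)"
      using measurable_space[OF KL] by (intro nn_integral_cong) (simp add: in_space_prob_algebra)
    finally show "emeasure (distr u p fst) A = emeasure p A" by simp
  qed simp
  moreover have "distr u r snd = r"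
  proof (rule measure_eqI)
    fix C assume "C \<in> sets (distr u r snd)"
    then have [measurable]: "C \<in> sets r" by simp
    have "emeasure (distr u r snd) C = emeasure u (space p \<times> C)"
      using sets.sets_into_space[OF \<open>C \<in> sets r\<close>]
      by (subst emeasure_distr) (auto simp: space_u intro!: arg_cong[where f = "emeasure u"])
    also have "\<dots> = (\<integral>\<^sup>+z. emeasure (L (snd z)) C \<partial>s)"
      unfolding u_s[OF sets.top \<open>C \<in> sets r\<close>]
      by (intro nn_integral_cong) (auto simp: couplingsD(6)[OF s])
    also have "\<dots> = (\<integral>\<^sup>+y. emeasure (L y) C \<partial>q)"
      by (rule nn_integral_coupling_snd[OF s]) measurable
    also have "\<dots> = (\<integral>\<^sup>+z. indicator C (snd z) \<partial>t)"
      using any_forward[OF L, of "\<lambda>_. 1" C] by simp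
    also have "\<dots> = emeasure r C"
      by (subst nn_integral_coupling_snd[OF t]) simp_all
    finally show "emeasure (distr u r snd) C = emeasure r C" .
  qed simp
  ultimately show "compose_couplings p q r t s \<in> couplings p r"
    unfolding comp couplings_def using u by simp
qed

lemma identity_coupling_eq:
  assumes "prob_space p"
  shows "identity_coupling p = distr p (p \<Otimes>\<^sub>M p) (\<lambda>x. (x, x))"
  unfolding identity_coupling_def
proof (rule measure_by_rectangles_eq)
  interpret prob_space p by fact
  show "finite_measure (distr p (p \<Otimes>\<^sub>M p) (\<lambda>x. (x, x)))"
    by (intro prob_space.finite_measure prob_space_distr) simp
  fix A C assume "A \<in> sets p" "C \<in> sets p"
  then show "emeasure (distr p (p \<Otimes>\<^sub>M p) (\<lambda>x. (x, x))) (A \<times> C) = emeasure p (A \<inter> C)"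
    using sets.sets_into_space[of A p]
    by (subst emeasure_distr) (auto intro!: arg_cong[where f = "emeasure p"])
qed simp

lemma identity_coupling_kernel:
  assumes "prob_space p"
  shows "identity_coupling p \<in> couplings p p"
    and "disintegrates p p (identity_coupling p) (return p)"
proof -
  interpret prob_space p by fact
  show "identity_coupling p \<in> couplings p p"
    unfolding identity_coupling_eq[OF assms] couplings_def
    by (auto simp: space_prob_algebra distr_distr comp_def intro!: prob_space_distr)
  show "disintegrates p p (identity_coupling p) (return p)"
    unfolding identity_coupling_eq[OF assms] disintegrates_def
  proof (intro conjI ballI)
    fix A B assume [measurable]: "A \<in> sets p" "B \<in> sets p"
    have "(\<integral>\<^sup>+x\<in>A. emeasure (return p x) B \<partial>p) = (\<integral>\<^sup>+x. indicator (A \<inter> B) x \<partial>p)"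
      by (intro nn_integral_cong) (auto simp: indicator_def)
    also have "\<dots> = emeasure (distr p (p \<Otimes>\<^sub>M p) (\<lambda>x. (x, x))) (A \<times> B)"
      using sets.sets_into_space[of A p]
      by (subst emeasure_distr) (auto intro!: arg_cong[where f = "emeasure p"])
    finally show "(\<integral>\<^sup>+x\<in>A. emeasure (return p x) B \<partial>p) = emeasure (distr p (p \<Otimes>\<^sub>M p) (\<lambda>x. (x, x))) (A \<times> B)" .
  qed simp
qed

section \<open>The category of couplings\<close>

lemma coupling_cat_simps[simp]:
  "Obj (coupling_cat X) = space (prob_algebra X)"
  "Hom (coupling_cat X) = couplings"
  "Idn (coupling_cat X) = identity_coupling"
  "Cmp (coupling_cat X) = compose_couplings"
  by (simp_all add: coupling_cat_def)

lemma coupling_eqI: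
  assumes s: "s \<in> couplings p q" "s' \<in> couplings p q"
    and K: "disintegrates p q s K" "disintegrates p q s' K'"
    and eq: "\<And>x. x \<in> space p \<Longrightarrow> K x = K' x"
  shows "s = s'"
  using disintegrates_unique[OF coupling_prob_space(1)[OF s(1)] couplingsD(2)[OF s(1)] couplingsD(2)[OF s(2)] K eq] .

text \<open>
  In terms of kernels the category laws are the monad laws of the probability monad.
\<close>

lemma category_coupling_cat:
  assumes X: "standard_borel X"
  shows "category (coupling_cat X)"
proof -
  have sb: "standard_borel p" and prob: "prob_space p" if "p \<in> space (prob_algebra X)" for p
    using that standard_borel_cong[OF X] by (auto simp: space_prob_algebra)
  have kernel: "\<exists>K. disintegrates p q s K"
    if "q \<in> space (prob_algebra X)" "s \<in> couplings p q" for p q s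
    using coupling_disintegration_exists[OF that(2) sb[OF that(1)]] .
  show ?thesis
  proof (unfold_locales, unfold coupling_cat_simps)
    fix a assume a: "a \<in> space (prob_algebra X)"
    show "identity_coupling a \<in> couplings a a"
      by (rule identity_coupling_kernel[OF prob[OF a]])
  next
    fix a b c f g
    assume a: "a \<in> space (prob_algebra X)" and b: "b \<in> space (prob_algebra X)" and c: "c \<in> space (prob_algebra X)"
      and f: "f \<in> couplings a b" and g: "g \<in> couplings b c"
    obtain K L where "disintegrates a b f K" "disintegrates b c g L"
      using kernel[OF b f] kernel[OF c g] by blast
    then show "compose_couplings a b c g f \<in> couplings a c"
      by (rule compose_couplings_kernel(1)[OF f g sb[OF a] sb[OF c]])
  next
    fix a b f
    assume a: "a \<in> space (prob_algebra X)" and b: "b \<in> space (prob_algebra X)" and f: "f \<in> couplings a b"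
    obtain K where K: "disintegrates a b f K"
      using kernel[OF b f] by blast
    note K' = measurable_prob_algebraD[OF disintegrates_measurable[OF K]]
    note ida = identity_coupling_kernel[OF prob[OF a]] and idb = identity_coupling_kernel[OF prob[OF b]]
    show "compose_couplings a a b f (identity_coupling a) = f"
      by (rule coupling_eqI[OF _ f _ K])
        (rule compose_couplings_kernel[OF ida(1) f sb[OF a] sb[OF b] ida(2) K] bind_return[OF K'] | assumption)+
    have "K x \<bind> return b = K x" if "x \<in> space a" for x
      using kernel_sets[OF prob[OF a] disintegrates_measurable[OF K] that] by (rule bind_return'')
    then show "compose_couplings a b b (identity_coupling b) f = f"
      by (rule coupling_eqI[OF compose_couplings_kernel(1)[OF f idb(1) sb[OF a] sb[OF b] K idb(2)] f
            compose_couplings_kernel(2)[OF f idb(1) sb[OF a] sb[OF b] K idb(2)] K])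
  next
    fix a b c d f g h
    assume a: "a \<in> space (prob_algebra X)" and b: "b \<in> space (prob_algebra X)"
      and c: "c \<in> space (prob_algebra X)" and d: "d \<in> space (prob_algebra X)"
      and f: "f \<in> couplings a b" and g: "g \<in> couplings b c" and h: "h \<in> couplings c d"
    obtain K L M where K: "disintegrates a b f K" and L: "disintegrates b c g L" and M: "disintegrates c d h M"
      using kernel[OF b f] kernel[OF c g] kernel[OF d h] by blast
    note gf = compose_couplings_kernel[OF f g sb[OF a] sb[OF c] K L]
    note hg = compose_couplings_kernel[OF g h sb[OF b] sb[OF d] L M]
    note h_gf = compose_couplings_kernel[OF gf(1) h sb[OF a] sb[OF d] gf(2) M]
    note hg_f = compose_couplings_kernel[OF f hg(1) sb[OF a] sb[OF d] K hg(2)]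
    show "compose_couplings a c d h (compose_couplings a b c g f) =
      compose_couplings a b d (compose_couplings b c d h g) f"
    proof (rule coupling_eqI[OF h_gf(1) hg_f(1) h_gf(2) hg_f(2)])
      fix x assume x: "x \<in> space a"
      have "sets (K x) = sets b"
        by (rule kernel_sets[OF prob[OF a] disintegrates_measurable[OF K] x])
      then have "L \<in> K x \<rightarrow>\<^sub>M subprob_algebra c"
        using measurable_prob_algebraD[OF disintegrates_measurable[OF L]] by (simp cong: measurable_cong_sets)
      then show "K x \<bind> L \<bind> M = K x \<bind> (\<lambda>x. L x \<bind> M)"
        by (rule bind_assoc[OF _ measurable_prob_algebraD[OF disintegrates_measurable[OF M]]])
    qed
  qed
qed

section \<open>Push-forward along a measurable retract\<close>

text \<open>
  A measurable left inverse \<open>J\<close> of \<open>i\<close> whose fixed points \<open>i (J y) = y\<close> form a measurable set. The set of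
  fixed points is the range of \<open>i\<close>; it carries every pushed-forward measure.
\<close>

locale measurable_retract =
  fixes X :: "'a measure" and Y :: "'b measure" and i :: "'a \<Rightarrow> 'b" and J :: "'b \<Rightarrow> 'a"
  assumes i_meas[measurable]: "i \<in> X \<rightarrow>\<^sub>M Y" and J_meas[measurable]: "J \<in> Y \<rightarrow>\<^sub>M X"
    and J_i: "\<And>x. x \<in> space X \<Longrightarrow> J (i x) = x"
    and fixpoints: "{y \<in> space Y. i (J y) = y} \<in> sets Y"
    and sb_X: "standard_borel X" and sb_Y: "standard_borel Y"
begin

lemma push_obj_in:
  assumes "p \<in> space (prob_algebra X)"
  shows "push_obj Y i p \<in> space (prob_algebra Y)"
proof -
  have [measurable_cong]: "sets p = sets X" and "prob_space p" using assms by (auto simp: space_prob_algebra)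
  interpret prob_space p by fact
  show ?thesis by (auto simp: push_obj_def space_prob_algebra intro!: prob_space_distr)
qed

lemma objD:
  assumes "p \<in> space (prob_algebra X)"
  shows "prob_space p" "sets p = sets X" "space p = space X" "standard_borel p"
  using assms sets_eq_imp_space_eq[of p X] standard_borel_cong[OF sb_X]
  by (auto simp: space_prob_algebra)

lemma map_prod_measurable[measurable]:
  "map_prod i i \<in> X \<Otimes>\<^sub>M X \<rightarrow>\<^sub>M Y \<Otimes>\<^sub>M Y"
  "map_prod J J \<in> Y \<Otimes>\<^sub>M Y \<rightarrow>\<^sub>M X \<Otimes>\<^sub>M X"
  unfolding map_prod_def by measurable

lemma i_meas_obj:
  assumes "p \<in> space (prob_algebra X)"
  shows "i \<in> p \<rightarrow>\<^sub>M Y" "map_prod i i \<in> p \<Otimes>\<^sub>M p \<rightarrow>\<^sub>M Y \<Otimes>\<^sub>M Y"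
  using i_meas map_prod_measurable(1) objD(2)[OF assms]
  by (simp_all cong: measurable_cong_sets sets_pair_measure_cong)

lemma push_objD:
  assumes "p \<in> space (prob_algebra X)"
  shows "prob_space (push_obj Y i p)" "sets (push_obj Y i p) = sets Y" "space (push_obj Y i p) = space Y"
    "standard_borel (push_obj Y i p)"
  using push_obj_in[OF assms] sets_eq_imp_space_eq[of "push_obj Y i p" Y] standard_borel_cong[OF sb_Y]
  by (auto simp: space_prob_algebra)

context
  fixes p q :: "'a measure"
  assumes p: "p \<in> space (prob_algebra X)" and q: "q \<in> space (prob_algebra X)"
begin

interpretation p: prob_space p by (rule objD[OF p])

lemmas [measurable_cong] = objD(2)[OF p] objD(2)[OF q] push_objD(2)[OF p] push_objD(2)[OF q]

lemma sets_hom: "s \<in> couplings p q \<Longrightarrow> sets s = sets (X \<Otimes>\<^sub>M X)"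
  using couplingsD(2)[of s p q] objD(2)[OF p] objD(2)[OF q] by (simp cong: sets_pair_measure_cong)

lemma sets_push_hom: "t \<in> couplings (push_obj Y i p) (push_obj Y i q) \<Longrightarrow> sets t = sets (Y \<Otimes>\<^sub>M Y)"
  using couplingsD(2)[of t "push_obj Y i p" "push_obj Y i q"] push_objD(2)[OF p] push_objD(2)[OF q]
  by (simp cong: sets_pair_measure_cong)

lemma push_arr_in:
  assumes s: "s \<in> couplings p q"
  shows "push_arr Y i p q s \<in> couplings (push_obj Y i p) (push_obj Y i q)"
proof -
  note [measurable_cong] = sets_hom[OF s]
  interpret prob_space s by (rule couplingsD(1)[OF s])
  have "distr s Y (\<lambda>z. i (fst z)) = distr (distr s p fst) Y i"
    by (subst distr_distr) (simp_all add: comp_def)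
  moreover have "distr s Y (\<lambda>z. i (snd z)) = distr (distr s q snd) Y i"
    by (subst distr_distr) (simp_all add: comp_def)
  moreover have "sets (Y \<Otimes>\<^sub>M Y) = sets (push_obj Y i p \<Otimes>\<^sub>M push_obj Y i q)"
    by (simp add: push_obj_def)
  ultimately show ?thesis
    using couplingsD(3,4)[OF s] unfolding couplings_def push_arr_def
    by (auto simp: space_prob_algebra distr_distr comp_def push_obj_def map_prod_def case_prod_beta
        intro!: prob_space_distr cong: distr_cong)
qed

text \<open>
  A kernel from \<open>X\<close> is transported to \<open>Y\<close> by reading the source point through \<open>J\<close>. Outside the range of
  \<open>i\<close> this is arbitrary, but that set is null for \<open>push_obj Y i p\<close>.
\<close>

lemma push_arr_kernel:
  assumes s: "s \<in> couplings p q" and K: "disintegrates p q s K"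
  shows "disintegrates (push_obj Y i p) (push_obj Y i q) (push_arr Y i p q s) (\<lambda>y. distr (K (J y)) Y i)"
  unfolding disintegrates_def
proof (intro conjI ballI)
  note [measurable_cong] = sets_hom[OF s]
  have K'[measurable]: "K \<in> p \<rightarrow>\<^sub>M prob_algebra q" by (rule disintegrates_measurable[OF K])
  have "(\<lambda>y. distr (K (J y)) (push_obj Y i q) i) \<in> push_obj Y i p \<rightarrow>\<^sub>M prob_algebra (push_obj Y i q)"
    by measurable
  moreover have "distr (K (J y)) (push_obj Y i q) i = distr (K (J y)) Y i" for y
    by (rule distr_cong) (simp_all add: push_obj_def)
  ultimately show KJ: "(\<lambda>y. distr (K (J y)) Y i) \<in> push_obj Y i p \<rightarrow>\<^sub>M prob_algebra (push_obj Y i q)"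
    by simp
  fix A B assume A: "A \<in> sets (push_obj Y i p)" and B: "B \<in> sets (push_obj Y i q)"
  then have [measurable]: "A \<in> sets Y" "B \<in> sets Y" by (simp_all add: push_obj_def)
  define A' B' where "A' = i -` A \<inter> space X" and "B' = i -` B \<inter> space X"
  have [measurable]: "A' \<in> sets X" "B' \<in> sets X" unfolding A'_def B'_def by measurable
  have [measurable]: "(\<lambda>y. emeasure (distr (K (J y)) Y i) B) \<in> borel_measurable Y"
    using measurable_compose[OF measurable_prob_algebraD[OF KJ] measurable_emeasure_subprob_algebra[OF B]]
    by (simp add: push_obj_def)
  have "(\<integral>\<^sup>+y\<in>A. emeasure (distr (K (J y)) Y i) B \<partial>push_obj Y i p)
    = (\<integral>\<^sup>+x. emeasure (distr (K (J (i x))) Y i) B * indicator A (i x) \<partial>p)"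
    unfolding push_obj_def by (rule nn_integral_distr) measurable
  also have "\<dots> = (\<integral>\<^sup>+x\<in>A'. emeasure (K x) B' \<partial>p)"
  proof (rule nn_integral_cong)
    fix x assume x: "x \<in> space p"
    then have "x \<in> space X" by (simp add: objD(3)[OF p])
    have "sets (K x) = sets X"
      using kernel_sets[OF p.prob_space_axioms K' x] objD(2)[OF q] by simp
    then have "emeasure (distr (K x) Y i) B = emeasure (K x) B'"
      using sets_eq_imp_space_eq[of "K x" X]
      by (subst emeasure_distr) (auto simp: B'_def cong: measurable_cong_sets)
    then show "emeasure (distr (K (J (i x))) Y i) B * indicator A (i x) = emeasure (K x) B' * indicator A' x"
      using \<open>x \<in> space X\<close> by (simp add: J_i A'_def indicator_def)
  qed
  also have "\<dots> = emeasure s (A' \<times> B')"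
    using K objD(2)[OF p] objD(2)[OF q] by (simp add: disintegrates_def)
  also have "\<dots> = emeasure (push_arr Y i p q s) (A \<times> B)"
    unfolding push_arr_def
    by (subst emeasure_distr)
      (auto simp: A'_def B'_def couplingsD(6)[OF s] objD(3)[OF p] objD(3)[OF q] intro!: arg_cong[where f = "emeasure s"])
  finally show "(\<integral>\<^sup>+y\<in>A. emeasure (distr (K (J y)) Y i) B \<partial>push_obj Y i p) = emeasure (push_arr Y i p q s) (A \<times> B)" .
qed

text \<open>
  Pushing forward along \<open>J\<close> inverts pushing forward along \<open>i\<close>. For a coupling \<open>t\<close> of pushed-forward
  measures, both coordinates lie in the range of \<open>i\<close> almost surely, because the marginals do; there
  \<open>i \<circ> J\<close> is the identity.
\<close>

lemma bij_push_arr: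
  "bij_betw (push_arr Y i p q) (couplings p q) (couplings (push_obj Y i p) (push_obj Y i q))"
proof (rule bij_betw_byWitness[where f' = "\<lambda>t. distr t (p \<Otimes>\<^sub>M q) (map_prod J J)"])
  show "push_arr Y i p q ` couplings p q \<subseteq> couplings (push_obj Y i p) (push_obj Y i q)"
    using push_arr_in by auto
  show "\<forall>s\<in>couplings p q. distr (push_arr Y i p q s) (p \<Otimes>\<^sub>M q) (map_prod J J) = s"
  proof
    fix s assume s: "s \<in> couplings p q"
    note [measurable_cong] = sets_hom[OF s]
    have "distr (push_arr Y i p q s) (p \<Otimes>\<^sub>M q) (map_prod J J) =
      distr s (p \<Otimes>\<^sub>M q) (map_prod J J \<circ> map_prod i i)"
      unfolding push_arr_def map_prod_def case_prod_beta by (rule distr_distr) measurable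
    also have "\<dots> = distr s s (\<lambda>z. z)"
      using couplingsD(2)[OF s]
      by (intro distr_cong) (auto simp: couplingsD(6)[OF s] objD(3)[OF p] objD(3)[OF q] J_i)
    finally show "distr (push_arr Y i p q s) (p \<Otimes>\<^sub>M q) (map_prod J J) = s" by simp
  qed
  have AE_fix: "AE y in push_obj Y i r. i (J y) = y" if "r \<in> space (prob_algebra X)" for r
  proof -
    have "i \<in> r \<rightarrow>\<^sub>M Y" using i_meas objD(2)[OF that] by (simp cong: measurable_cong_sets)
    then show ?thesis
      unfolding push_obj_def using fixpoints
      by (subst AE_distr_iff) (auto simp: objD(3)[OF that] J_i)
  qed
  have pull_back: "distr t X (\<lambda>z. J (f z)) = r"
    if r: "r \<in> space (prob_algebra X)" and t: "distr t (push_obj Y i r) f = push_obj Y i r"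
      and f: "f \<in> t \<rightarrow>\<^sub>M push_obj Y i r" for t :: "('b \<times> 'b) measure" and f r
  proof -
    note [measurable_cong] = objD(2)[OF r] push_objD(2)[OF r]
    have "distr t X (\<lambda>z. J (f z)) = distr (distr t (push_obj Y i r) f) X J"
      using f by (subst distr_distr) (simp_all add: comp_def)
    also have "\<dots> = distr r X (\<lambda>x. J (i x))"
      unfolding t unfolding push_obj_def by (subst distr_distr) (simp_all add: comp_def)
    also have "\<dots> = distr r r (\<lambda>x. x)"
      by (intro distr_cong) (simp_all add: objD[OF r] J_i)
    finally show ?thesis by simp
  qed
  show "(\<lambda>t. distr t (p \<Otimes>\<^sub>M q) (map_prod J J)) ` couplings (push_obj Y i p) (push_obj Y i q) \<subseteq> couplings p q"
  proof (rule image_subsetI)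
    fix t assume t: "t \<in> couplings (push_obj Y i p) (push_obj Y i q)"
    note [measurable_cong] = sets_push_hom[OF t]
    interpret prob_space t by (rule couplingsD(1)[OF t])
    have "distr t p (\<lambda>z. J (fst z)) = p" "distr t q (\<lambda>z. J (snd z)) = q"
      using pull_back[OF p couplingsD(3)[OF t]] pull_back[OF q couplingsD(4)[OF t]]
        distr_cong[OF refl objD(2)[OF p], of t "\<lambda>z. J (fst z)"] distr_cong[OF refl objD(2)[OF q], of t "\<lambda>z. J (snd z)"]
      by simp_all
    then show "distr t (p \<Otimes>\<^sub>M q) (map_prod J J) \<in> couplings p q"
      by (auto simp: couplings_def space_prob_algebra distr_distr comp_def map_prod_def case_prod_beta intro!: prob_space_distr)
  qed
  show "\<forall>t\<in>couplings (push_obj Y i p) (push_obj Y i q). push_arr Y i p q (distr t (p \<Otimes>\<^sub>M q) (map_prod J J)) = t"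
  proof
    fix t assume t: "t \<in> couplings (push_obj Y i p) (push_obj Y i q)"
    note [measurable_cong] = sets_push_hom[OF t]
    have "AE z in distr t (push_obj Y i p) fst. i (J z) = z" "AE z in distr t (push_obj Y i q) snd. i (J z) = z"
      unfolding couplingsD(3,4)[OF t] using AE_fix p q by blast+
    then have "AE z in t. i (J (fst z)) = fst z" "AE z in t. i (J (snd z)) = snd z"
      by (auto dest!: AE_distrD[rotated])
    then have fix_t: "AE z in t. map_prod i i (map_prod J J z) = z"
      by eventually_elim (auto simp: map_prod_def case_prod_beta)
    have "push_arr Y i p q (distr t (p \<Otimes>\<^sub>M q) (map_prod J J)) =
      distr t (Y \<Otimes>\<^sub>M Y) (map_prod i i \<circ> map_prod J J)"
      unfolding push_arr_def map_prod_def case_prod_beta by (rule distr_distr) measurable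
    also have "\<dots> = distr t t (\<lambda>z. z)"
      using fix_t by (intro distr_cong_AE) (auto simp: sets_push_hom[OF t] map_prod_def case_prod_beta)
    finally show "push_arr Y i p q (distr t (p \<Otimes>\<^sub>M q) (map_prod J J)) = t" by simp
  qed
qed

end

lemma push_arr_identity:
  assumes p: "p \<in> space (prob_algebra X)"
  shows "push_arr Y i p p (identity_coupling p) = identity_coupling (push_obj Y i p)"
proof -
  note [measurable_cong] = objD(2)[OF p] push_objD(2)[OF p]
  show ?thesis
    unfolding identity_coupling_eq[OF objD(1)[OF p]] identity_coupling_eq[OF push_objD(1)[OF p]]
    using i_meas_obj[OF p]
    unfolding push_arr_def push_obj_def
    by (simp add: distr_distr comp_def map_prod_def case_prod_beta cong: distr_cong)
qed

text \<open>
  Both sides have a kernel of the form \<open>y \<mapsto> distr (K (J y) \<bind> L) Y i\<close>: the passage through \<open>i\<close> and back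
  through \<open>J\<close> between the two factors cancels.
\<close>

lemma push_arr_compose:
  assumes p: "p \<in> space (prob_algebra X)" and q: "q \<in> space (prob_algebra X)" and r: "r \<in> space (prob_algebra X)"
    and s: "s \<in> couplings p q" and t: "t \<in> couplings q r"
  shows "push_arr Y i p r (compose_couplings p q r t s) =
    compose_couplings (push_obj Y i p) (push_obj Y i q) (push_obj Y i r) (push_arr Y i q r t) (push_arr Y i p q s)"
proof -
  obtain K L where K: "disintegrates p q s K" and L: "disintegrates q r t L"
    using coupling_disintegration_exists[OF s objD(4)[OF q]] coupling_disintegration_exists[OF t objD(4)[OF r]]
    by blast
  note comp = compose_couplings_kernel[OF s t objD(4)[OF p] objD(4)[OF r] K L]
  note push_comp = compose_couplings_kernel[OF push_arr_in[OF p q s] push_arr_in[OF q r t] push_objD(4)[OF p] push_objD(4)[OF r]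
    push_arr_kernel[OF p q s K] push_arr_kernel[OF q r t L]]
  show ?thesis
  proof (rule coupling_eqI[OF push_arr_in[OF p r comp(1)] push_comp(1) push_arr_kernel[OF p r comp] push_comp(2)])
    fix y assume "y \<in> space (push_obj Y i p)"
    then have Jy: "J y \<in> space p"
      using measurable_space[OF J_meas] by (simp add: push_objD(3)[OF p] objD(3)[OF p])
    note L_meas = measurable_prob_algebraD[OF disintegrates_measurable[OF L]]
    define M where "M = K (J y)"
    have M: "M \<in> space (prob_algebra q)"
      unfolding M_def by (rule measurable_space[OF disintegrates_measurable[OF K] Jy])
    have M_ne: "space M \<noteq> {}" and sets_M: "sets M = sets q"
      using M prob_space.not_empty by (auto simp: space_prob_algebra)
    have sp: "space M = space X" using sets_eq_imp_space_eq[OF sets_M] objD(3)[OF q] by simp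
    note [measurable_cong] = sets_M objD(2)[OF q] objD(2)[OF r]
    have [measurable]: "L \<in> M \<rightarrow>\<^sub>M subprob_algebra r" "L \<in> X \<rightarrow>\<^sub>M subprob_algebra r"
      using L_meas sets_M objD(2)[OF q] by (simp_all cong: measurable_cong_sets)
    have [measurable]: "(\<lambda>z. distr z Y i) \<in> subprob_algebra r \<rightarrow>\<^sub>M subprob_algebra Y"
      by (rule measurable_distr[OF i_meas_obj(1)[OF r]])
    have "distr (M \<bind> L) Y i = M \<bind> (\<lambda>x. distr (L x) Y i)"
      by (rule distr_bind[OF _ M_ne i_meas_obj(1)[OF r]]) measurable
    also have "\<dots> = M \<bind> (\<lambda>x. distr (L (J (i x))) Y i)"
      by (rule bind_cong) (simp_all add: sp J_i)
    also have "\<dots> = distr M Y i \<bind> (\<lambda>y. distr (L (J y)) Y i)"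
    proof (rule bind_distr[symmetric, OF _ _ M_ne])
      show "i \<in> M \<rightarrow>\<^sub>M Y"
        using i_meas_obj(1)[OF q] sets_M by (simp cong: measurable_cong_sets)
      show "(\<lambda>y. distr (L (J y)) Y i) \<in> Y \<rightarrow>\<^sub>M subprob_algebra Y"
        by measurable
    qed
    finally show "distr (K (J y) \<bind> L) Y i = distr (K (J y)) Y i \<bind> (\<lambda>y. distr (L (J y)) Y i)"
      by (simp add: M_def)
  qed
qed

lemma full_embedding_push:
  "full_embedding (coupling_cat X) (coupling_cat Y) (push_obj Y i) (push_arr Y i)"
proof (intro full_embedding.intro cat_functor.intro category_coupling_cat sb_X sb_Y)
  show "cat_functor_axioms (coupling_cat X) (coupling_cat Y) (push_obj Y i) (push_arr Y i)"
    by unfold_locales (simp_all add: push_obj_in push_arr_in push_arr_identity push_arr_compose)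
  show "full_embedding_axioms (coupling_cat X) (coupling_cat Y) (push_obj Y i) (push_arr Y i)"
    by unfold_locales (simp add: bij_push_arr)
qed

end

section \<open>Minkowski's inequality\<close>

lemma convex_power_nonneg: "convex_on {0..} (\<lambda>x::real. x ^ n)"
proof (cases "even n")
  case True
  then show ?thesis
    by (rule convex_on_subset[OF convex_power_even]) auto
qed (rule convex_power_odd)

text \<open>
  Convexity of the power function, at the point that divides the segment from \<open>u / a\<close> to \<open>v / b\<close> with
  weights proportional to \<open>a\<close> and \<open>b\<close>.
\<close>

lemma power_add_le_weighted:
  fixes u v a b :: real
  assumes "0 \<le> u" "0 \<le> v" "0 < a" "0 < b"
  shows "(u + v) ^ Suc m \<le> (a + b) ^ m * (u ^ Suc m / a ^ m + v ^ Suc m / b ^ m)"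
proof -
  define l where "l = b / (a + b)"
  have l: "0 \<le> l" "l \<le> 1" "1 - l = a / (a + b)"
    using assms by (auto simp: l_def field_simps)
  have "((1 - l) * (u / a) + l * (v / b)) ^ Suc m \<le> (1 - l) * (u / a) ^ Suc m + l * (v / b) ^ Suc m"
    using convex_onD[OF convex_power_nonneg l(1,2), of "u / a" "v / b" "Suc m"] assms by simp
  also have "(1 - l) * (u / a) + l * (v / b) = (u + v) / (a + b)"
    unfolding l(3) unfolding l_def using assms by (simp add: add_divide_distrib)
  also have "(1 - l) * (u / a) ^ Suc m + l * (v / b) ^ Suc m = (u ^ Suc m / a ^ m + v ^ Suc m / b ^ m) / (a + b)"
    unfolding l(3) unfolding l_def using assms by (simp add: power_divide add_divide_distrib mult.commute)
  finally have "(u + v) ^ Suc m / (a + b) ^ Suc m \<le> (u ^ Suc m / a ^ m + v ^ Suc m / b ^ m) / (a + b)"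
    by (simp add: power_divide)
  then have "(u + v) ^ Suc m / (a + b) ^ Suc m * (a + b) ^ Suc m
    \<le> (u ^ Suc m / a ^ m + v ^ Suc m / b ^ m) / (a + b) * (a + b) ^ Suc m"
    using assms by (intro mult_right_mono) auto
  then show ?thesis using assms by (simp add: mult_ac)
qed

lemma ennreal_power_add_le_weighted:
  fixes u v :: ennreal
  assumes "0 < a" "0 < b"
  shows "(u + v) ^ Suc m \<le> ennreal ((a + b) ^ m) * (ennreal (1 / a ^ m) * u ^ Suc m + ennreal (1 / b ^ m) * v ^ Suc m)"
proof (cases "u = \<infinity> \<or> v = \<infinity>")
  case True
  have "ennreal (1 / a ^ m) \<noteq> 0" "ennreal (1 / b ^ m) \<noteq> 0" "ennreal ((a + b) ^ m) \<noteq> 0"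
    using assms by (auto simp: ennreal_eq_0_iff not_le)
  then show ?thesis using True
    by (auto simp: ennreal_mult_eq_top_iff ennreal_top_mult ennreal_mult_top top_power_ennreal)
next
  case False
  then obtain x y where xy: "u = ennreal x" "0 \<le> x" "v = ennreal y" "0 \<le> y"
    by (cases u; cases v) auto
  have "(u + v) ^ Suc m = ennreal ((x + y) ^ Suc m)"
    using xy by (simp add: ennreal_power del: power_Suc flip: ennreal_plus)
  also have "\<dots> \<le> ennreal ((a + b) ^ m * (1 / a ^ m * x ^ Suc m + 1 / b ^ m * y ^ Suc m))"
    using power_add_le_weighted[OF xy(2,4) assms, of m] by (intro ennreal_leI) simp
  also have "\<dots> = ennreal ((a + b) ^ m) * (ennreal (1 / a ^ m) * ennreal (x ^ Suc m) + ennreal (1 / b ^ m) * ennreal (y ^ Suc m))"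
    using assms xy by (subst ennreal_mult, simp, simp, subst ennreal_plus, simp, simp, subst (1 2) ennreal_mult) auto
  also have "\<dots> = ennreal ((a + b) ^ m) * (ennreal (1 / a ^ m) * u ^ Suc m + ennreal (1 / b ^ m) * v ^ Suc m)"
    using xy by (simp only: ennreal_power)
  finally show ?thesis .
qed

lemma ennreal_root_power:
  assumes "0 < k" shows "ennreal_root k x ^ k = x"
  using assms by (cases x) (auto simp: ennreal_root_def ennreal_power top_power_ennreal)

lemma power_le_imp_ennreal_root_le:
  assumes "0 < k" "x \<le> y ^ k"
  shows "ennreal_root k x \<le> y"
proof (cases y)
  case (real b)
  then have "x \<le> ennreal (b ^ k)" using assms(2) by (simp add: ennreal_power)
  then obtain a where a: "x = ennreal a" "0 \<le> a" "a \<le> b ^ k"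
    using real by (cases x) (auto simp: top_unique)
  have "root k a \<le> root k (b ^ k)" using a assms(1) by simp
  also have "\<dots> = b" using assms(1) real by (simp add: real_root_power_cancel)
  finally show ?thesis using a real by (simp add: ennreal_root_def ennreal_leI)
qed simp

lemma ennreal_root_mono:
  assumes "0 < k" "x \<le> y"
  shows "ennreal_root k x \<le> ennreal_root k y"
  using assms by (intro power_le_imp_ennreal_root_le) (auto simp: ennreal_root_power)

text \<open>
  Minkowski's inequality. If \<open>a\<close> and \<open>b\<close> are the norms of \<open>f\<close> and \<open>g\<close>, integrating
  \<open>ennreal_power_add_le_weighted\<close> bounds the \<open>k\<close>-th power of the norm of \<open>f + g\<close> by
  \<open>(a + b) ^ (k - 1) * (a + b)\<close>. The weights must be positive, so \<open>a\<close> and \<open>b\<close> are first increased by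
  \<open>e / 2\<close>, which covers the case of a vanishing norm.
\<close>

theorem minkowski_nn_integral:
  assumes [measurable]: "f \<in> borel_measurable M" "g \<in> borel_measurable M" and k: "0 < k"
  shows "ennreal_root k (\<integral>\<^sup>+x. (f x + g x) ^ k \<partial>M)
    \<le> ennreal_root k (\<integral>\<^sup>+x. f x ^ k \<partial>M) + ennreal_root k (\<integral>\<^sup>+x. g x ^ k \<partial>M)"
proof (cases "ennreal_root k (\<integral>\<^sup>+x. f x ^ k \<partial>M) = \<infinity> \<or> ennreal_root k (\<integral>\<^sup>+x. g x ^ k \<partial>M) = \<infinity>")
  case False
  then obtain a b where a: "ennreal_root k (\<integral>\<^sup>+x. f x ^ k \<partial>M) = ennreal a" "0 \<le> a"
    and b: "ennreal_root k (\<integral>\<^sup>+x. g x ^ k \<partial>M) = ennreal b" "0 \<le> b"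
    by (metis ennreal_cases infinity_ennreal_def)
  obtain m where m: "k = Suc m" using k by (cases k) auto
  have int_f: "(\<integral>\<^sup>+x. f x ^ k \<partial>M) = ennreal (a ^ k)"
    using a ennreal_root_power[OF k, of "\<integral>\<^sup>+x. f x ^ k \<partial>M"] by (simp add: ennreal_power)
  have int_g: "(\<integral>\<^sup>+x. g x ^ k \<partial>M) = ennreal (b ^ k)"
    using b ennreal_root_power[OF k, of "\<integral>\<^sup>+x. g x ^ k \<partial>M"] by (simp add: ennreal_power)
  show ?thesis
    unfolding a b
  proof (rule ennreal_le_epsilon)
    fix e :: real assume "0 < e"
    define a' b' where "a' = a + e / 2" and "b' = b + e / 2"
    have pos: "0 < a'" "0 < b'" "a \<le> a'" "b \<le> b'" using a b \<open>0 < e\<close> by (auto simp: a'_def b'_def)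
    have "(\<integral>\<^sup>+x. (f x + g x) ^ k \<partial>M) \<le>
      (\<integral>\<^sup>+x. ennreal ((a' + b') ^ m) * (ennreal (1 / a' ^ m) * f x ^ k + ennreal (1 / b' ^ m) * g x ^ k) \<partial>M)"
      unfolding m by (intro nn_integral_mono ennreal_power_add_le_weighted pos)
    also have "\<dots> = ennreal ((a' + b') ^ m) * (ennreal (1 / a' ^ m) * ennreal (a ^ k) + ennreal (1 / b' ^ m) * ennreal (b ^ k))"
      by (simp add: nn_integral_cmult nn_integral_add int_f int_g)
    also have "\<dots> = ennreal ((a' + b') ^ m * (a ^ k / a' ^ m + b ^ k / b' ^ m))"
      using pos a b by (simp flip: ennreal_mult ennreal_plus)
    also have "\<dots> \<le> ennreal ((a' + b') ^ k)"
    proof (rule ennreal_leI)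
      have "a ^ k / a' ^ m \<le> a' ^ k / a' ^ m" "b ^ k / b' ^ m \<le> b' ^ k / b' ^ m"
        using pos a b by (auto intro!: divide_right_mono power_mono)
      then have "a ^ k / a' ^ m + b ^ k / b' ^ m \<le> a' + b'"
        using pos by (simp add: m)
      then have "(a' + b') ^ m * (a ^ k / a' ^ m + b ^ k / b' ^ m) \<le> (a' + b') ^ m * (a' + b')"
        using pos by (intro mult_left_mono) auto
      then show "(a' + b') ^ m * (a ^ k / a' ^ m + b ^ k / b' ^ m) \<le> (a' + b') ^ k"
        by (simp add: m mult.commute)
    qed
    also have "\<dots> = (ennreal a + ennreal b + ennreal e) ^ k"
    proof -
      have "ennreal a + ennreal b + ennreal e = ennreal (a' + b')"
        using a b \<open>0 < e\<close> by (simp add: a'_def b'_def flip: ennreal_plus)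
      then show ?thesis using pos by (simp only: ennreal_power add_nonneg_nonneg less_imp_le)
    qed
    finally show "ennreal_root k (\<integral>\<^sup>+x. (f x + g x) ^ k \<partial>M) \<le> ennreal a + ennreal b + ennreal e"
      by (rule power_le_imp_ennreal_root_le[OF k])
  qed
qed auto

section \<open>Costs of couplings\<close>

lemma weighted_coupling_cat_simps[simp]:
  "Obj (weighted_coupling_cat k X c) = space (prob_algebra X)"
  "Hom (weighted_coupling_cat k X c) = couplings"
  "Idn (weighted_coupling_cat k X c) = identity_coupling"
  "Cmp (weighted_coupling_cat k X c) = compose_couplings"
  "Wgt (weighted_coupling_cat k X c) = (\<lambda>_ _ s. coupling_cost k c s)"
  by (simp_all add: weighted_coupling_cat_def coupling_cat_def cat.defs weighted_cat.defs)

lemma coupling_cost_identity: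
  assumes p: "prob_space p" "sets p = sets X" and c: "cost_function X c" and k: "0 < k"
  shows "coupling_cost k c (identity_coupling p) = 0"
proof -
  note [measurable_cong] = p(2)
  have [measurable]: "case_prod c \<in> borel_measurable (X \<Otimes>\<^sub>M X)" and c0: "\<And>x. x \<in> space X \<Longrightarrow> c x x = 0"
    using c by (auto simp: cost_function_def)
  have "(\<integral>\<^sup>+(x, y). c x y ^ k \<partial>identity_coupling p) = (\<integral>\<^sup>+x. c x x ^ k \<partial>p)"
    unfolding identity_coupling_eq[OF p(1)] by (subst nn_integral_distr) (simp_all add: case_prod_beta)
  also have "\<dots> = (\<integral>\<^sup>+x. 0 \<partial>p)"
    using k sets_eq_imp_space_eq[OF p(2)] by (intro nn_integral_cong) (simp add: c0)
  finally show ?thesis by (simp add: coupling_cost_def ennreal_root_def)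
qed

text \<open>
  Gluing \<open>s\<close> and \<open>t\<close> along \<open>q\<close> gives a law \<open>w\<close> of triples \<open>((x, y), z)\<close> whose marginals are \<open>s\<close>, \<open>t\<close> and
  their composite. The triangle inequality holds pointwise under \<open>w\<close>, and Minkowski's inequality
  passes it to the costs.
\<close>

lemma coupling_cost_compose:
  assumes s: "s \<in> couplings p q" and t: "t \<in> couplings q r"
    and sb: "standard_borel p" "standard_borel q" "standard_borel r"
    and c_meas[measurable]: "case_prod c \<in> borel_measurable (p \<Otimes>\<^sub>M q)"
      "case_prod d \<in> borel_measurable (q \<Otimes>\<^sub>M r)" "case_prod e \<in> borel_measurable (p \<Otimes>\<^sub>M r)"
    and triangle: "\<And>x y z. \<lbrakk>x \<in> space p; y \<in> space q; z \<in> space r\<rbrakk> \<Longrightarrow> e x z \<le> c x y + d y z"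
    and k: "0 < k"
  shows "coupling_cost k e (compose_couplings p q r t s) \<le> coupling_cost k d t + coupling_cost k c s"
proof -
  note p = coupling_prob_space(1)[OF s] and q = coupling_prob_space(2)[OF s]
  obtain K L where K: "disintegrates p q s K" and L: "disintegrates q r t L"
    using coupling_disintegration_exists[OF s sb(2)] coupling_disintegration_exists[OF t sb(3)] by blast
  note K' = disintegrates_measurable[OF K] and L' = disintegrates_measurable[OF L]
  have Ls': "(\<lambda>z. L (snd z)) \<in> p \<Otimes>\<^sub>M q \<rightarrow>\<^sub>M prob_algebra r"
    by (rule measurable_compose[OF measurable_snd L'])
  then have Ls: "(\<lambda>z. L (snd z)) \<in> s \<rightarrow>\<^sub>M prob_algebra r"
    using couplingsD(2)[OF s] by (simp cong: measurable_cong_sets)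
  let ?P = "(p \<Otimes>\<^sub>M q) \<Otimes>\<^sub>M r"
  define w where "w = kernel_pair s r (\<lambda>z. L (snd z))"
  have sets_sr: "sets (s \<Otimes>\<^sub>M r) = sets ?P"
    using couplingsD(2)[OF s] by (rule sets_pair_measure_cong) simp
  have w: "(\<integral>\<^sup>+v. h v \<partial>w) = (\<integral>\<^sup>+v. \<integral>\<^sup>+z. h (v, z) \<partial>L (snd v) \<partial>s)"
    if "h \<in> borel_measurable ?P" for h
    unfolding w_def using that sets_sr
    by (intro nn_integral_kernel_pair[OF couplingsD(1)[OF s] Ls]) (simp cong: measurable_cong_sets)
  have sets_w[measurable_cong]: "sets w = sets ?P"
    using kernel_pair_space[OF couplingsD(1)[OF s] Ls] sets_sr by (simp add: w_def space_prob_algebra)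
  have space_w: "space w = (space p \<times> space q) \<times> space r"
    using sets_eq_imp_space_eq[OF sets_w] by (simp add: space_pair_measure)
  have prob_L: "emeasure (L y) (space (L y)) = 1" if "y \<in> space q" for y
    using measurable_space[OF L' that] by (auto simp: space_prob_algebra intro: prob_space.emeasure_space_1)

  have cost_s: "(\<integral>\<^sup>+(x, y). c x y ^ k \<partial>s) = (\<integral>\<^sup>+v. c (fst (fst v)) (snd (fst v)) ^ k \<partial>w)"
  proof -
    have "(\<integral>\<^sup>+v. c (fst (fst v)) (snd (fst v)) ^ k \<partial>w) = (\<integral>\<^sup>+v. \<integral>\<^sup>+z. c (fst v) (snd v) ^ k \<partial>L (snd v) \<partial>s)"
      by (subst w) simp_all
    also have "\<dots> = (\<integral>\<^sup>+(x, y). c x y ^ k \<partial>s)"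
      by (intro nn_integral_cong) (auto simp: couplingsD(6)[OF s] prob_L)
    finally show ?thesis by simp
  qed
  have cost_t: "(\<integral>\<^sup>+(y, z). d y z ^ k \<partial>t) = (\<integral>\<^sup>+v. d (snd (fst v)) (snd v) ^ k \<partial>w)"
  proof -
    have inner: "(\<lambda>y. \<integral>\<^sup>+z. d y z ^ k \<partial>L y) \<in> borel_measurable q"
      by (rule nn_integral_measurable_subprob_algebra2[OF _ measurable_prob_algebraD[OF L']]) measurable
    have "(\<integral>\<^sup>+v. d (snd (fst v)) (snd v) ^ k \<partial>w) = (\<integral>\<^sup>+v. \<integral>\<^sup>+z. d (snd v) z ^ k \<partial>L (snd v) \<partial>s)"
      by (subst w) simp_all
    also have "\<dots> = (\<integral>\<^sup>+y. \<integral>\<^sup>+z. d y z ^ k \<partial>L y \<partial>q)"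
      by (rule nn_integral_coupling_snd[OF s inner])
    also have "\<dots> = (\<integral>\<^sup>+(y, z). d y z ^ k \<partial>t)"
      by (subst nn_integral_disintegrates[OF q couplingsD(2)[OF t] L]) simp_all
    finally show ?thesis by simp
  qed
  note comp = compose_couplings_kernel[OF s t sb(1,3) K L]
  have cost_comp: "(\<integral>\<^sup>+(x, z). e x z ^ k \<partial>compose_couplings p q r t s) = (\<integral>\<^sup>+v. e (fst (fst v)) (snd v) ^ k \<partial>w)"
  proof -
    have inner: "(\<lambda>v. \<integral>\<^sup>+z. e (fst v) z ^ k \<partial>L (snd v)) \<in> borel_measurable (p \<Otimes>\<^sub>M q)"
      by (rule nn_integral_measurable_subprob_algebra2[OF _ measurable_prob_algebraD[OF Ls']]) measurable
    have "(\<integral>\<^sup>+(x, z). e x z ^ k \<partial>compose_couplings p q r t s) = (\<integral>\<^sup>+x. \<integral>\<^sup>+z. e x z ^ k \<partial>(K x \<bind> L) \<partial>p)"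
      by (subst nn_integral_disintegrates[OF p couplingsD(2)[OF comp(1)] comp(2)]) simp_all
    also have "\<dots> = (\<integral>\<^sup>+x. \<integral>\<^sup>+y. \<integral>\<^sup>+z. e x z ^ k \<partial>L y \<partial>K x \<partial>p)"
    proof (rule nn_integral_cong)
      fix x assume x[measurable]: "x \<in> space p"
      have "L \<in> K x \<rightarrow>\<^sub>M subprob_algebra r"
        using measurable_prob_algebraD[OF L'] kernel_sets[OF p K' x] by (simp cong: measurable_cong_sets)
      moreover have "(\<lambda>z. e x z ^ k) \<in> borel_measurable r"
        by measurable
      ultimately show "(\<integral>\<^sup>+z. e x z ^ k \<partial>(K x \<bind> L)) = (\<integral>\<^sup>+y. \<integral>\<^sup>+z. e x z ^ k \<partial>L y \<partial>K x)"
        by (intro nn_integral_bind)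
    qed
    also have "\<dots> = (\<integral>\<^sup>+v. \<integral>\<^sup>+z. e (fst v) z ^ k \<partial>L (snd v) \<partial>s)"
      using nn_integral_disintegrates[OF p couplingsD(2)[OF s] K inner] by simp
    also have "\<dots> = (\<integral>\<^sup>+v. e (fst (fst v)) (snd v) ^ k \<partial>w)"
      by (subst w) simp_all
    finally show ?thesis .
  qed
  have "(\<integral>\<^sup>+v. e (fst (fst v)) (snd v) ^ k \<partial>w)
    \<le> (\<integral>\<^sup>+v. (d (snd (fst v)) (snd v) + c (fst (fst v)) (snd (fst v))) ^ k \<partial>w)"
  proof (intro nn_integral_mono power_mono)
    fix v assume "v \<in> space w"
    then show "e (fst (fst v)) (snd v) \<le> d (snd (fst v)) (snd v) + c (fst (fst v)) (snd (fst v))"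
      using triangle[of "fst (fst v)" "snd (fst v)" "snd v"] by (auto simp: space_w add.commute)
  qed simp
  then have "ennreal_root k (\<integral>\<^sup>+v. e (fst (fst v)) (snd v) ^ k \<partial>w)
    \<le> ennreal_root k (\<integral>\<^sup>+v. (d (snd (fst v)) (snd v) + c (fst (fst v)) (snd (fst v))) ^ k \<partial>w)"
    by (rule ennreal_root_mono[OF k])
  also have "\<dots> \<le> ennreal_root k (\<integral>\<^sup>+v. d (snd (fst v)) (snd v) ^ k \<partial>w) + ennreal_root k (\<integral>\<^sup>+v. c (fst (fst v)) (snd (fst v)) ^ k \<partial>w)"
    by (rule minkowski_nn_integral[OF _ _ k]) measurable
  finally show ?thesis
    unfolding coupling_cost_def cost_s cost_t cost_comp .
qed

lemma category_weighted_coupling_cat: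
  assumes "standard_borel X"
  shows "category (weighted_coupling_cat k X c)"
  using category_coupling_cat[OF assms] by (simp add: category_def)

lemma weighted_category_coupling_cat:
  assumes X: "standard_borel X" and c: "cost_function X c" and k: "0 < k"
  shows "weighted_category (weighted_coupling_cat k X c)"
proof (intro weighted_category.intro category_weighted_coupling_cat X)
  show "weighted_category_axioms (weighted_coupling_cat k X c)"
  proof (unfold_locales, unfold weighted_coupling_cat_simps)
    fix p assume "p \<in> space (prob_algebra X)"
    then show "coupling_cost k c (identity_coupling p) = 0"
      using coupling_cost_identity[OF _ _ c k] by (simp add: space_prob_algebra)
  next
    fix p q r s t
    assume "p \<in> space (prob_algebra X)" "q \<in> space (prob_algebra X)" "r \<in> space (prob_algebra X)"
      and s: "s \<in> couplings p q" and t: "t \<in> couplings q r"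
    then have sets: "sets p = sets X" "sets q = sets X" "sets r = sets X"
      by (simp_all add: space_prob_algebra)
    note spaces = this[THEN sets_eq_imp_space_eq]
    have c_meas: "case_prod c \<in> borel_measurable (a \<Otimes>\<^sub>M b)" if "sets a = sets X" "sets b = sets X" for a b
      using c sets_pair_measure_cong[OF that] by (simp add: cost_function_def cong: measurable_cong_sets)
    show "coupling_cost k c (compose_couplings p q r t s) \<le> coupling_cost k c t + coupling_cost k c s"
      using c by (intro coupling_cost_compose[OF s t] sets[THEN standard_borel_cong[OF X]] c_meas sets k)
        (simp add: cost_function_def spaces)
  qed
qed

context measurable_retract
begin

lemma coupling_cost_push:
  assumes p: "p \<in> space (prob_algebra X)" and q: "q \<in> space (prob_algebra X)" and s: "s \<in> couplings p q"
    and cY: "cost_function Y cY" and iso: "isometric_embedding X cX cY i"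
  shows "coupling_cost k cY (push_arr Y i p q s) = coupling_cost k cX s"
proof -
  have [measurable]: "case_prod cY \<in> borel_measurable (Y \<Otimes>\<^sub>M Y)" using cY by (simp add: cost_function_def)
  have "map_prod i i \<in> s \<rightarrow>\<^sub>M Y \<Otimes>\<^sub>M Y"
    using map_prod_measurable(1) sets_hom[OF p q s] by (simp cong: measurable_cong_sets)
  then have "(\<integral>\<^sup>+(x, y). cY x y ^ k \<partial>push_arr Y i p q s) = (\<integral>\<^sup>+z. cY (i (fst z)) (i (snd z)) ^ k \<partial>s)"
    unfolding push_arr_def by (subst nn_integral_distr) (simp_all add: case_prod_beta)
  also have "\<dots> = (\<integral>\<^sup>+(x, y). cX x y ^ k \<partial>s)"
    using iso
    by (intro nn_integral_cong) (auto simp: couplingsD(6)[OF s] objD(3)[OF p] objD(3)[OF q] isometric_embedding_def)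
  finally show ?thesis by (simp add: coupling_cost_def)
qed

lemma weighted_embedding_push:
  assumes cX: "cost_function X cX" and cY: "cost_function Y cY" and iso: "isometric_embedding X cX cY i"
    and k: "0 < k"
  shows "weighted_embedding (weighted_coupling_cat k X cX) (weighted_coupling_cat k Y cY) (push_obj Y i) (push_arr Y i)"
proof (intro weighted_embedding.intro weighted_functor.intro cat_functor.intro
    category_weighted_coupling_cat weighted_category_coupling_cat sb_X sb_Y cX cY k)
  show "cat_functor_axioms (weighted_coupling_cat k X cX) (weighted_coupling_cat k Y cY) (push_obj Y i) (push_arr Y i)"
    by unfold_locales (simp_all add: push_obj_in push_arr_in push_arr_identity push_arr_compose)
  show "weighted_functor_axioms (weighted_coupling_cat k X cX) (weighted_coupling_cat k Y cY) (push_obj Y i) (push_arr Y i)"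
    by unfold_locales (simp add: coupling_cost_push[OF _ _ _ cY iso])
  show "weighted_embedding_axioms (weighted_coupling_cat k X cX) (weighted_coupling_cat k Y cY) (push_obj Y i) (push_arr Y i)"
    by unfold_locales (simp_all add: bij_push_arr coupling_cost_push[OF _ _ _ cY iso])
qed

end

section \<open>Measurable embeddings of standard Borel spaces\<close>

lemma measurable_retract_exists:
  assumes X: "standard_borel X" "space X \<noteq> {}" and Y: "standard_borel Y" and emb: "measurable_embedding X Y i"
  shows "\<exists>J. measurable_retract X Y i J"
proof -
  have i: "i \<in> X \<rightarrow>\<^sub>M Y" by (rule measurable_embedding_measurable[OF emb])
  have "space Y \<noteq> {}" using X(2) measurable_space[OF i] by auto
  then obtain g M where gM: "real_coding Y g M" using standard_borel_real_coding[OF Y] by blast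
  obtain f L where fL: "real_coding X f L" using standard_borel_real_coding[OF X] by blast
  obtain J where J: "J \<in> Y \<rightarrow>\<^sub>M X" "\<And>x. x \<in> space X \<Longrightarrow> J (i x) = x"
    using measurable_embedding_left_inverse[OF emb fL] by blast
  have "{y \<in> space Y. i (J y) = y} \<in> sets Y"
    using measurable_compose[OF J(1) i] by (intro real_coding_equalizer[OF gM]) auto
  with i J X Y have "measurable_retract X Y i J"
    by (simp add: measurable_retract_def)
  then show ?thesis by blast
qed

theorem proposition5p4:
  fixes X :: "'a measure" and Y :: "'b measure" and i :: "'a \<Rightarrow> 'b"
  assumes "standard_borel X" and "standard_borel Y" and "measurable_embedding X Y i"
  shows "full_embedding (coupling_cat X) (coupling_cat Y) (push_obj Y i) (push_arr Y i) \<and>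
    (\<forall>cX cY. cost_function X cX \<and> cost_function Y cY \<and> isometric_embedding X cX cY i \<longrightarrow>
      (\<forall>k\<ge>1. weighted_embedding (weighted_coupling_cat k X cX) (weighted_coupling_cat k Y cY)
        (push_obj Y i) (push_arr Y i)))"
proof (cases "space X = {}")
  case False
  obtain J where "measurable_retract X Y i J"
    using measurable_retract_exists[OF assms(1) False assms(2,3)] ..
  then interpret measurable_retract X Y i J .
  show ?thesis
    using full_embedding_push weighted_embedding_push by (auto simp: Suc_le_eq)
next
  case True
  \<comment> \<open>An empty space carries no probability measure, so everything about the source is vacuous.\<close>
  have empty: "p \<notin> space (prob_algebra X)" for p
  proof
    assume "p \<in> space (prob_algebra X)"
    then have "sets p = sets X" "prob_space p" by (simp_all add: space_prob_algebra)
    then show False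
      using True sets_eq_imp_space_eq[of p X] prob_space.not_empty[of p] by blast
  qed
  have "full_embedding (coupling_cat X) (coupling_cat Y) (push_obj Y i) (push_arr Y i)"
    by (intro full_embedding.intro cat_functor.intro category_coupling_cat assms)
      (unfold_locales, simp_all add: empty)
  moreover have "weighted_embedding (weighted_coupling_cat k X cX) (weighted_coupling_cat k Y cY) (push_obj Y i) (push_arr Y i)"
    if "cost_function X cX" "cost_function Y cY" "1 \<le> k" for cX cY k
    using that
    by (intro weighted_embedding.intro weighted_functor.intro cat_functor.intro
        category_weighted_coupling_cat weighted_category_coupling_cat assms)
      (unfold_locales, simp_all add: empty)
  ultimately show ?thesis by blast
qed

end
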